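(* Let $(T,\sigma)$ be a random fibered system satisfying conditions (i)–(iv) listed in the context, and let $P_\omega=\mathcal L_{T_\omega}$ be the Perron–Frobenius operator of $T_\omega$. Then, for $\mathbb P$-almost every $\omega\in\Omega$, $\{P^{(n)}_{\sigma^{-n}\omega}1_X\}_n$ is weakly precompact in $L^1(X,m)$. That is, there exists a random invariant density $h\in L^1(\Omega,L^1(X,m))$ for the cocycle $(P,\sigma)$ such that $(\mathscr P^{*})^{n}1_{\operatorname{supp}h}(\omega,x)$ tends monotonically to $1$ as $n\to\infty$ for $\mathbb P\times m$-almost every $(\omega,x)\in\Omega\times X$.
   Context: $(X,\mathcal A,m)$ and $(\Omega,\mathcal F,\mathbb P)$ are standard probability spaces and $\sigma:\Omega\to\Omega$ is invertible, $\mathbb P$-preserving and ergodic. For each $\omega\in\Omega$, $T_\omega:X\to X$ is a non-singular transformation ($m\circ T_\omega^{-1}\ll m$), with $(\omega,x)\mapsto T_\omega x$ measurable, and $T^{(n)}_\omega=T_{\sigma^{n-1}\omega}\circ\cdots\circ T_\omega$, so $T^{(n)}_{\sigma^{-n}\omega}=T_{\sigma^{-1}\omega}\circ\cdots\circ T_{\sigma^{-n}\omega}$. Let $I$ be a non-empty countable set. The random fibered system $(T,\sigma)$ has the following properties. (i) There exists an $\omega$-independent partition $\{X_i\}_{i\in I}$ of $X$ (up to $m$-null sets) such that $T_\omega|_{X_i}:X_i\to T_\omega X_i$ is invertible for each $i\in I$. Write $X^\omega_{i_1\dots i_n}=X_{i_1}\cap T_{\sigma^{-n}\omega}^{-1}X_{i_2}\cap\cdots\cap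 T_{\sigma^{-n}\omega}^{-1}\circ\cdots\circ T_{\sigma^{-2}\omega}^{-1}X_{i_n}$ for the cylinders, and $V^\omega_{i_1\dots i_n}:T^{(n)}_{\sigma^{-n}\omega}X^\omega_{i_1\dots i_n}\to X^\omega_{i_1\dots i_n}$ for the local inverses of $T^{(n)}_{\sigma^{-n}\omega}$. (ii) (Generator condition) For $\mathbb P$-almost every $\omega$, the $\sigma$-algebra generated by the cylinder sets $\{X^\omega_{i_1\dots i_n}:n\ge1,\ i_1,\dots,i_n\in I\}$ is $\mathcal A$ modulo $m$-null sets. (iii) (Bounded distortion) There exists $C\ge1$ such that for $\mathbb P$-almost every $\omega$ and any non-empty cylinder $X^\omega_{i_1\dots i_n}$, $$\operatorname*{ess\,sup}_{x\in T^{(n)}_{\sigma^{-n}\omega}X^\omega_{i_1\dots i_n}}\frac{d(m\circ V^\omega_{i_1\dots i_n})}{dm}(x)\le C\operatorname*{ess\,inf}_{x\in T^{(n)}_{\sigma^{-n}\omega}X^\omega_{i_1\dots i_n}}\frac{d(m\circ V^\omega_{i_1\dots i_n})}{dm}(x).$$ (iv) There exists a constant $c>0$ such that, for $\mathbb P$-almost every $\omega$, for any $n\ge1$ and any non-empty cylinder $X^\omega_{i_1\dots i_n}$, $m(T^{(n)}_{\sigma^{-n}\omega}X^\omega_{i_1\dots i_n})>c$. The Perron–Frobenius operator $\mathcal L_{T_\omega}:L^1(X,m)\to L^1(X,m)$ is defined by $\int_X\mathcal L_{T_\omega}f\cdot g\,dm=\int_Xf\cdot g\circ T_\omega\,dm$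 for $f\in L^1(X,m)$, $g\in L^\infty(X,m)$. $P^{(n)}_\omega=P_{\sigma^{n-1}\omega}\circ\cdots\circ P_\omega$, so that $P^{(n)}_{\sigma^{-n}\omega}=P_{\sigma^{-1}\omega}\circ\cdots\circ P_{\sigma^{-n}\omega}$ is the Perron–Frobenius operator of $T^{(n)}_{\sigma^{-n}\omega}$. A subset of $L^1(X,m)$ is weakly precompact if every sequence in it has a weakly convergent subsequence in $L^1(X,m)$. A random invariant density is a measurable map $h:\Omega\to L^1(X,m)$, $h(\omega)=h_\omega$, with $h_\omega\ge0$, $\|h_\omega\|_{L^1(X)}=1$ and $P_\omega h_\omega=h_{\sigma\omega}$ for $\mathbb P$-almost every $\omega$. The Bochner space $L^1(\Omega,L^1(X,m))$ is identified with $L^1(\Omega\times X,\mathbb P\times m)$ via $f(\omega,x)=f_\omega(x)$; the lift operator is $(\mathscr Pf)(\omega)=P_{\sigma^{-1}\omega}f_{\sigma^{-1}\omega}$, $\mathscr P^*$ is its adjoint on $L^\infty(\Omega\times X,\mathbb P\times m)$, and $\operatorname{supp}h=\{h\ne0\}$ up to null sets. *)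

theory Defs
  imports "HOL-Probability.Probability"
begin

definition standard_prob_space :: "'a measure \<Rightarrow> bool" where
  "standard_prob_space M \<longleftrightarrow> prob_space M \<and>
     (\<exists>S. completely_metrizable_space S \<and> second_countable S \<and> topspace S = space M \<and>
          sets M = sigma_sets (space M) {U. openin S U})"

definition measure_preserving_on :: "'w measure \<Rightarrow> ('w \<Rightarrow> 'w) \<Rightarrow> bool" where
  "measure_preserving_on \<Omega> \<sigma> \<longleftrightarrow> \<sigma> \<in> \<Omega> \<rightarrow>\<^sub>M \<Omega> \<and> distr \<Omega> \<Omega> \<sigma> = \<Omega>"

definition ergodic_on :: "'w measure \<Rightarrow> ('w \<Rightarrow> 'w) \<Rightarrow> bool" where
  "ergodic_on \<Omega> \<sigma> \<longleftrightarrow>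
     (\<forall>A\<in>sets \<Omega>. \<sigma> -` A \<inter> space \<Omega> = A \<longrightarrow> emeasure \<Omega> A = 0 \<or> emeasure \<Omega> (space \<Omega> - A) = 0)"

abbreviation inv_on :: "'w measure \<Rightarrow> ('w \<Rightarrow> 'w) \<Rightarrow> 'w \<Rightarrow> 'w" where
  "inv_on \<Omega> \<sigma> \<equiv> the_inv_into (space \<Omega>) \<sigma>"

text \<open>Invertibility is meant in the category of measurable spaces; on a standard Borel space
  the measurability of the inverse of a measurable bijection is automatic. The same applies to
  the branches of a fibered system below, which are only required to be bijective onto their
  images.\<close>

definition invertible_on :: "'w measure \<Rightarrow> ('w \<Rightarrow> 'w) \<Rightarrow> bool" where
  "invertible_on \<Omega> \<sigma> \<longleftrightarrow> \<sigma> \<in> \<Omega> \<rightarrow>\<^sub>M \<Omega> \<and> bij_betw \<sigma> (space \<Omega>) (space \<Omega>) \<and> inv_on \<Omega> \<sigma> \<in> \<Omega> \<rightarrow>\<^sub>M \<Omega>"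

definition nonsingular :: "'a measure \<Rightarrow> ('a \<Rightarrow> 'a) \<Rightarrow> bool" where
  "nonsingular M S \<longleftrightarrow> S \<in> M \<rightarrow>\<^sub>M M \<and> absolutely_continuous M (distr M M S)"

text \<open>\<open>A\<^sup>(\<^sup>n\<^sup>)\<^sub>\<omega> = A\<^bsub>\<sigma>\<^sup>n\<^sup>-\<^sup>1 \<omega>\<^esub> \<circ> \<dots> \<circ> A\<^sub>\<omega>\<close>; used both for the maps \<open>T\<^sub>\<omega>\<close> on \<open>X\<close> and for their
  transfer operators.\<close>

primrec cocycle :: "('w \<Rightarrow> 'w) \<Rightarrow> ('w \<Rightarrow> 'b \<Rightarrow> 'b) \<Rightarrow> nat \<Rightarrow> 'w \<Rightarrow> 'b \<Rightarrow> 'b" where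
  "cocycle \<sigma> A 0 \<omega> = id"
| "cocycle \<sigma> A (Suc n) \<omega> = A ((\<sigma> ^^ n) \<omega>) \<circ> cocycle \<sigma> A n \<omega>"

text \<open>\<open>A\<^sup>(\<^sup>n\<^sup>)\<close> started at \<open>\<sigma>\<^sup>-\<^sup>n \<omega>\<close>.\<close>

definition pullback_cocycle ::
    "'w measure \<Rightarrow> ('w \<Rightarrow> 'w) \<Rightarrow> ('w \<Rightarrow> 'b \<Rightarrow> 'b) \<Rightarrow> nat \<Rightarrow> 'w \<Rightarrow> 'b \<Rightarrow> 'b" where
  "pullback_cocycle \<Omega> \<sigma> A n \<omega> = cocycle \<sigma> A n ((inv_on \<Omega> \<sigma> ^^ n) \<omega>)"


section \<open>Random fibered systems\<close>

locale random_system =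
  fixes \<Omega> :: "'w measure" and \<sigma> :: "'w \<Rightarrow> 'w"
    and M :: "'a measure" and T :: "'w \<Rightarrow> 'a \<Rightarrow> 'a"
  assumes standard_base: "standard_prob_space \<Omega>"
    and standard_fibre: "standard_prob_space M"
    and invertible_base: "invertible_on \<Omega> \<sigma>"
    and preserving_base: "measure_preserving_on \<Omega> \<sigma>"
    and ergodic_base: "ergodic_on \<Omega> \<sigma>"
    and nonsingular_fibre: "\<And>\<omega>. \<omega> \<in> space \<Omega> \<Longrightarrow> nonsingular M (T \<omega>)"
    and jointly_measurable: "(\<lambda>(\<omega>, x). T \<omega> x) \<in> \<Omega> \<Otimes>\<^sub>M M \<rightarrow>\<^sub>M M"

definition partition_mod_null :: "'a measure \<Rightarrow> 'i set \<Rightarrow> ('i \<Rightarrow> 'a set) \<Rightarrow> bool" where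
  "partition_mod_null M I X \<longleftrightarrow>
     (\<forall>i\<in>I. X i \<in> sets M) \<and>
     (\<forall>i\<in>I. \<forall>j\<in>I. i \<noteq> j \<longrightarrow> X i \<inter> X j \<in> null_sets M) \<and>
     space M - (\<Union>i\<in>I. X i) \<in> null_sets M"

text \<open>The word \<open>i\<^sub>1 \<dots> i\<^sub>n\<close> is a list, so \<open>i\<^sub>k\<^sub>+\<^sub>1\<close> is \<open>w ! k\<close>; the point \<open>x\<close> is followed under the
  fibre maps at \<open>\<sigma>\<^sup>-\<^sup>n \<omega>, \<dots>, \<sigma>\<^sup>-\<^sup>2 \<omega>\<close>.\<close>

definition cylinder ::
    "'w measure \<Rightarrow> ('w \<Rightarrow> 'w) \<Rightarrow> 'a measure \<Rightarrow> ('w \<Rightarrow> 'a \<Rightarrow> 'a) \<Rightarrow> ('i \<Rightarrow> 'a set) \<Rightarrow>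
      'w \<Rightarrow> 'i list \<Rightarrow> 'a set" where
  "cylinder \<Omega> \<sigma> M T X \<omega> w =
     (\<Inter>k<length w. cocycle \<sigma> T k ((inv_on \<Omega> \<sigma> ^^ length w) \<omega>) -` X (w ! k) \<inter> space M)"

abbreviation words :: "'i set \<Rightarrow> 'i list set" where
  "words I \<equiv> {w. w \<noteq> [] \<and> set w \<subseteq> I}"

definition cylinder_image ::
    "'w measure \<Rightarrow> ('w \<Rightarrow> 'w) \<Rightarrow> 'a measure \<Rightarrow> ('w \<Rightarrow> 'a \<Rightarrow> 'a) \<Rightarrow> ('i \<Rightarrow> 'a set) \<Rightarrow>
      'w \<Rightarrow> 'i list \<Rightarrow> 'a set" where
  "cylinder_image \<Omega> \<sigma> M T X \<omega> w =
     pullback_cocycle \<Omega> \<sigma> T (length w) \<omega> ` cylinder \<Omega> \<sigma> M T X \<omega> w"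

definition local_inverse ::
    "'w measure \<Rightarrow> ('w \<Rightarrow> 'w) \<Rightarrow> 'a measure \<Rightarrow> ('w \<Rightarrow> 'a \<Rightarrow> 'a) \<Rightarrow> ('i \<Rightarrow> 'a set) \<Rightarrow>
      'w \<Rightarrow> 'i list \<Rightarrow> 'a \<Rightarrow> 'a" where
  "local_inverse \<Omega> \<sigma> M T X \<omega> w =
     the_inv_into (cylinder \<Omega> \<sigma> M T X \<omega> w) (pullback_cocycle \<Omega> \<sigma> T (length w) \<omega>)"

text \<open>\<open>d(m \<circ> V)/dm\<close> for an injective \<open>V\<close> defined on \<open>Y\<close>, where \<open>(m \<circ> V)(A) = m(V(A))\<close>
  for measurable \<open>A \<subseteq> Y\<close>.\<close>

definition image_density :: "'a measure \<Rightarrow> 'a set \<Rightarrow> ('a \<Rightarrow> 'a) \<Rightarrow> 'a \<Rightarrow> ennreal" where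
  "image_density M Y V =
     RN_deriv (restrict_space M Y)
       (measure_of Y (sets (restrict_space M Y)) (\<lambda>A. emeasure M (V ` A)))"

text \<open>Dual to the library's \<^const>\<open>esssup\<close>.\<close>

definition essinf ::
    "'a measure \<Rightarrow> ('a \<Rightarrow> 'b::{second_countable_topology, dense_linorder, linorder_topology, complete_linorder}) \<Rightarrow> 'b" where
  "essinf M f = (if f \<in> borel_measurable M then Liminf (ae_filter M) f else bot)"

locale random_fibered_system = random_system \<Omega> \<sigma> M T
  for \<Omega> :: "'w measure" and \<sigma> :: "'w \<Rightarrow> 'w" and M :: "'a measure" and T :: "'w \<Rightarrow> 'a \<Rightarrow> 'a" +
  fixes I :: "'i set" and X :: "'i \<Rightarrow> 'a set"
  assumes index_nonempty: "I \<noteq> {}"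
    and index_countable: "countable I"
    and partition: "partition_mod_null M I X"
    and branch_invertible:
      "\<And>\<omega> i. \<omega> \<in> space \<Omega> \<Longrightarrow> i \<in> I \<Longrightarrow> bij_betw (T \<omega>) (X i) (T \<omega> ` X i)"
    and generator:
      "AE \<omega> in \<Omega>. \<forall>A\<in>sets M.
         \<exists>B\<in>sigma_sets (space M) (cylinder \<Omega> \<sigma> M T X \<omega> ` words I).
           (A - B) \<union> (B - A) \<in> null_sets M"
    and bounded_distortion:
      "\<exists>C\<ge>1. AE \<omega> in \<Omega>. \<forall>w\<in>words I. cylinder \<Omega> \<sigma> M T X \<omega> w \<noteq> {} \<longrightarrow>
         (let Y = cylinder_image \<Omega> \<sigma> M T X \<omega> w;
              D = image_density M Y (local_inverse \<Omega> \<sigma> M T X \<omega> w)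
          in esssup (restrict_space M Y) D \<le> ennreal C * essinf (restrict_space M Y) D)"
    and large_images:
      "\<exists>c>0. AE \<omega> in \<Omega>. \<forall>w\<in>words I. cylinder \<Omega> \<sigma> M T X \<omega> w \<noteq> {} \<longrightarrow>
         measure M (cylinder_image \<Omega> \<sigma> M T X \<omega> w) > c"


section \<open>Operators on \<open>L\<^sup>1\<close>\<close>

text \<open>Elements of \<open>L\<^sup>1\<close> and \<open>L\<^sup>\<infinity>\<close> are represented by functions, and operators select a
  representative of the image class, which is unique up to null sets. All statements about
  such functions are made almost everywhere.\<close>

definition Linf :: "'a measure \<Rightarrow> ('a \<Rightarrow> real) set" where
  "Linf M = {g \<in> borel_measurable M. \<exists>K. AE x in M. \<bar>g x\<bar> \<le> K}"

definition perron_frobenius :: "'a measure \<Rightarrow> ('a \<Rightarrow> 'a) \<Rightarrow> ('a \<Rightarrow> real) \<Rightarrow> 'a \<Rightarrow> real" where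
  "perron_frobenius M S f =
     (SOME f'. integrable M f' \<and>
        (\<forall>g\<in>Linf M. (\<integral>x. f' x * g x \<partial>M) = (\<integral>x. f x * g (S x) \<partial>M)))"

definition L1_functional :: "'a measure \<Rightarrow> (('a \<Rightarrow> real) \<Rightarrow> real) \<Rightarrow> bool" where
  "L1_functional M \<Lambda> \<longleftrightarrow>
     (\<forall>f g. integrable M f \<longrightarrow> integrable M g \<longrightarrow> \<Lambda> (\<lambda>x. f x + g x) = \<Lambda> f + \<Lambda> g) \<and>
     (\<forall>a f. integrable M f \<longrightarrow> \<Lambda> (\<lambda>x. a * f x) = a * \<Lambda> f) \<and>
     (\<exists>K. \<forall>f. integrable M f \<longrightarrow> \<bar>\<Lambda> f\<bar> \<le> K * (\<integral>x. \<bar>f x\<bar> \<partial>M))"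

definition weakly_converges_L1 :: "'a measure \<Rightarrow> (nat \<Rightarrow> 'a \<Rightarrow> real) \<Rightarrow> ('a \<Rightarrow> real) \<Rightarrow> bool" where
  "weakly_converges_L1 M u f \<longleftrightarrow> (\<forall>\<Lambda>. L1_functional M \<Lambda> \<longrightarrow> (\<lambda>n. \<Lambda> (u n)) \<longlonglongrightarrow> \<Lambda> f)"

definition weakly_precompact_L1 :: "'a measure \<Rightarrow> ('a \<Rightarrow> real) set \<Rightarrow> bool" where
  "weakly_precompact_L1 M F \<longleftrightarrow>
     (\<forall>f\<in>F. integrable M f) \<and>
     (\<forall>u :: nat \<Rightarrow> 'a \<Rightarrow> real. (\<forall>n. u n \<in> F) \<longrightarrow>
        (\<exists>r f. strict_mono r \<and> integrable M f \<and> weakly_converges_L1 M (u \<circ> r) f))"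

text \<open>A measurable map \<open>\<Omega> \<rightarrow> L\<^sup>1(X)\<close> is given by a jointly measurable function whose sections are
  integrable.\<close>

definition random_invariant_density ::
    "'w measure \<Rightarrow> ('w \<Rightarrow> 'w) \<Rightarrow> 'a measure \<Rightarrow> ('w \<Rightarrow> ('a \<Rightarrow> real) \<Rightarrow> 'a \<Rightarrow> real) \<Rightarrow>
      ('w \<Rightarrow> 'a \<Rightarrow> real) \<Rightarrow> bool" where
  "random_invariant_density \<Omega> \<sigma> M P h \<longleftrightarrow>
     case_prod h \<in> borel_measurable (\<Omega> \<Otimes>\<^sub>M M) \<and>
     (\<forall>\<omega>\<in>space \<Omega>. integrable M (h \<omega>)) \<and>
     (AE \<omega> in \<Omega>. (AE x in M. h \<omega> x \<ge> 0) \<and> (\<integral>x. \<bar>h \<omega> x\<bar> \<partial>M) = 1 \<and>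
                 (AE x in M. P \<omega> (h \<omega>) x = h (\<sigma> \<omega>) x))"

text \<open>The lift operator must return a jointly measurable representative: the sectionwise
  choices made by \<open>P\<close> need not fit together measurably.\<close>

definition lift_operator ::
    "'w measure \<Rightarrow> ('w \<Rightarrow> 'w) \<Rightarrow> 'a measure \<Rightarrow> ('w \<Rightarrow> ('a \<Rightarrow> real) \<Rightarrow> 'a \<Rightarrow> real) \<Rightarrow>
      ('w \<times> 'a \<Rightarrow> real) \<Rightarrow> 'w \<times> 'a \<Rightarrow> real" where
  "lift_operator \<Omega> \<sigma> M P f =
     (SOME F. integrable (\<Omega> \<Otimes>\<^sub>M M) F \<and>
        (AE \<omega> in \<Omega>. AE x in M.
           F (\<omega>, x) = P (inv_on \<Omega> \<sigma> \<omega>) (\<lambda>y. f (inv_on \<Omega> \<sigma> \<omega>, y)) x))"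

definition lift_adjoint ::
    "'w measure \<Rightarrow> ('w \<Rightarrow> 'w) \<Rightarrow> 'a measure \<Rightarrow> ('w \<Rightarrow> ('a \<Rightarrow> real) \<Rightarrow> 'a \<Rightarrow> real) \<Rightarrow>
      ('w \<times> 'a \<Rightarrow> real) \<Rightarrow> 'w \<times> 'a \<Rightarrow> real" where
  "lift_adjoint \<Omega> \<sigma> M P g =
     (SOME G. G \<in> Linf (\<Omega> \<Otimes>\<^sub>M M) \<and>
        (\<forall>f. integrable (\<Omega> \<Otimes>\<^sub>M M) f \<longrightarrow>
           (\<integral>z. lift_operator \<Omega> \<sigma> M P f z * g z \<partial>(\<Omega> \<Otimes>\<^sub>M M)) = (\<integral>z. f z * G z \<partial>(\<Omega> \<Otimes>\<^sub>M M))))"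

definition random_support :: "'w measure \<Rightarrow> 'a measure \<Rightarrow> ('w \<Rightarrow> 'a \<Rightarrow> real) \<Rightarrow> ('w \<times> 'a) set" where
  "random_support \<Omega> M h = {(\<omega>, x) \<in> space (\<Omega> \<Otimes>\<^sub>M M). h \<omega> x \<noteq> 0}"

end

theory Submission
  imports Defs
begin

text \<open>Everything rests on one uniform estimate. Let \<open>T\<^sup>(\<^sup>n\<^sup>)\<close> be the \<open>n\<close>-step map arriving at
  \<open>\<omega>\<close>, and let \<open>Z\<close> be one of its cylinders, with image \<open>Y\<close>. Bounded distortion compares the
  density of the inverse branch with its mean \<open>m(Z) / m(Y)\<close>, and \<open>m(Y) > c\<close>; hence
  \<open>m(Z \<inter> (T\<^sup>(\<^sup>n\<^sup>))\<^sup>-\<^sup>1 A) \<le> (C / c) m(Z) m(A)\<close>. The cylinders of length \<open>n\<close> partition \<open>X\<close> up to null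
  sets, so summation yields \<open>m((T\<^sup>(\<^sup>n\<^sup>))\<^sup>-\<^sup>1 A) \<le> K m(A)\<close> with \<open>K\<close> depending neither on \<open>n\<close> nor on
  \<open>\<omega>\<close> (\<open>pullback_measure_bound\<close>). In other words \<open>0 \<le> P\<^sup>(\<^sup>n\<^sup>) 1 \<le> K\<close>.

  A set of densities between \<open>0\<close> and \<open>K\<close> on a countably generated probability space is weakly precompact. The
  integrals over the sets of a countable generating \<open>\<pi>\<close>-system converge along a diagonal
  subsequence, a Dynkin argument extends this to all measurable sets, and the limiting set function
  has a density (\<open>dominated_additive_compact\<close>). Since functionals on \<open>L\<^sup>1\<close> are integration
  against bounded functions (\<open>L1_functional_representation\<close>), setwise convergence of bounded
  densities is weak convergence.

  For the invariant density, consider the skew product \<open>\<Theta>(\<omega>, x) = (\<sigma> \<omega>, T\<^sub>\<omega> x)\<close> on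
  \<open>\<Omega> \<times> X\<close>. It inherits the estimate (\<open>skew_measure_bound\<close>), so by the same compactness a
  subsequence of the averages of the measures \<open>A \<mapsto> (\<bbbP> \<times> m)(\<Theta>\<^sup>-\<^sup>k A)\<close> converges setwise to a
  measure with a bounded density \<open>h\<close>, which is \<open>\<Theta>\<close>-invariant. Each of these measures has marginal
  \<open>\<bbbP>\<close>, so the fibres \<open>h\<^sub>\<omega>\<close> have integral \<open>1\<close>. The set \<open>B\<close> of points that never visit the
  support of \<open>h\<close> satisfies \<open>B \<subseteq> \<Theta>\<^sup>-\<^sup>k B\<close> for all \<open>k\<close>, so it carries \<open>h\<close>-mass at least
  \<open>(\<bbbP> \<times> m)(B)\<close>; as \<open>h\<close> vanishes on \<open>B\<close>, it is null.

  Finally, the lift operator is the transfer operator of \<open>\<Theta>\<close>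
  (\<open>AE_perron_frobenius_skew_section\<close>), so its adjoint is composition with \<open>\<Theta>\<close>, and the functions
  in the theorem are the indicators of \<open>\<Theta>\<^sup>-\<^sup>n (supp h)\<close>. They increase because
  \<open>supp h \<subseteq> \<Theta>\<^sup>-\<^sup>1 (supp h)\<close> up to null sets, and they tend to \<open>1\<close> because almost every orbit visits
  the support.\<close>

section \<open>Countable generators\<close>

text \<open>Countability lets an identity that holds almost everywhere for each generating set hold
  almost everywhere for all of them at once, and lets a diagonal argument run over them; stability
  under intersections lets what holds on the generator spread to all measurable sets by Dynkin
  induction.\<close>

definition countable_pi_generator :: "'a measure \<Rightarrow> 'a set set \<Rightarrow> bool" where
  "countable_pi_generator M G \<longleftrightarrow> countable G \<and> Int_stable G \<and> space M \<in> G \<and>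
     G \<subseteq> Pow (space M) \<and> sets M = sigma_sets (space M) G"

lemma countable_pi_generator_in_sets:
  "countable_pi_generator M G \<Longrightarrow> A \<in> G \<Longrightarrow> A \<in> sets M"
  by (auto simp: countable_pi_generator_def)

text \<open>Finite intersections of a countable base of the topology form the generator.\<close>

lemma countable_pi_generator_standard:
  assumes "standard_prob_space M"
  obtains G where "countable_pi_generator M G"
proof -
  obtain S where S: "second_countable S" "topspace S = space M"
      "sets M = sigma_sets (space M) {U. openin S U}"
    using assms by (auto simp: standard_prob_space_def)
  obtain B where B: "countable B" "\<And>V. V \<in> B \<Longrightarrow> openin S V"
      "\<And>U x. openin S U \<Longrightarrow> x \<in> U \<Longrightarrow> \<exists>V\<in>B. x \<in> V \<and> V \<subseteq> U"
    using S(1) unfolding second_countable_def by meson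
  define G where "G = (\<lambda>F. space M \<inter> \<Inter>F) ` {F. F \<subseteq> B \<and> finite F}"
  have op: "openin S U" if "U \<in> G" for U
  proof -
    obtain F where F: "F \<subseteq> B" "finite F" "U = space M \<inter> \<Inter>F"
      using \<open>U \<in> G\<close> by (auto simp: G_def)
    have "openin S (topspace S \<inter> \<Inter>F)"
      using F(2,1) B(2) by (induction F) (auto simp: Int_left_commute intro: openin_Int)
    then show ?thesis using F S(2) by simp
  qed
  have "countable G"
    unfolding G_def using countable_Collect_finite_subset[OF B(1)] by (auto simp: conj_commute)
  moreover have "Int_stable G"
  proof (rule Int_stableI)
    fix a b assume "a \<in> G" "b \<in> G"
    then obtain F F' where F: "F \<subseteq> B" "finite F" "a = space M \<inter> \<Inter>F"
       "F' \<subseteq> B" "finite F'" "b = space M \<inter> \<Inter>F'"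
      by (auto simp: G_def)
    then have "a \<inter> b = space M \<inter> \<Inter>(F \<union> F')" by auto
    with F show "a \<inter> b \<in> G" by (auto simp: G_def)
  qed
  moreover have "space M \<in> G"
    unfolding G_def by (rule image_eqI[of _ _ "{}"]) auto
  moreover have sub: "G \<subseteq> Pow (space M)" by (auto simp: G_def)
  moreover have "sets M = sigma_sets (space M) G"
  proof
    show "sigma_sets (space M) G \<subseteq> sets M"
      unfolding S(3) using op by (intro sigma_sets_mono') auto
    have "U \<in> sigma_sets (space M) G" if U: "openin S U" for U
    proof -
      have "U = \<Union>{V\<in>B. V \<subseteq> U}" using B(3) U by blast
      moreover have "V \<in> sigma_sets (space M) G" if "V \<in> B" for V
      proof -
        have "V \<subseteq> space M" using B(2)[OF that] S(2) openin_subset by blast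
        then have "V = space M \<inter> \<Inter>{V}" by auto
        then have "V \<in> G" unfolding G_def using that by (intro image_eqI[of _ _ "{V}"]) auto
        then show ?thesis by (rule sigma_sets.Basic)
      qed
      moreover have "countable {V\<in>B. V \<subseteq> U}" using B(1) by auto
      ultimately show ?thesis
        using sigma_algebra.countable_Union[OF sigma_algebra_sigma_sets[OF sub], of "{V\<in>B. V \<subseteq> U}"]
        by auto
    qed
    then show "sets M \<subseteq> sigma_sets (space M) G"
      unfolding S(3) by (intro sigma_sets_mono) auto
  qed
  ultimately show ?thesis using that by (auto simp: countable_pi_generator_def)
qed

lemma countable_pi_generator_pair:
  assumes G: "countable_pi_generator M G" and H: "countable_pi_generator N H"
  shows "countable_pi_generator (M \<Otimes>\<^sub>M N) ((\<lambda>(A, B). A \<times> B) ` (G \<times> H))"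
proof -
  let ?GH = "(\<lambda>(A, B). A \<times> B) ` (G \<times> H)"
  have "countable ?GH" using G H by (auto simp: countable_pi_generator_def)
  moreover have "Int_stable ?GH"
  proof (rule Int_stableI)
    fix a b assume "a \<in> ?GH" "b \<in> ?GH"
    then obtain A B A' B' where "A \<in> G" "A' \<in> G" "B \<in> H" "B' \<in> H"
      and ab: "a = A \<times> B" "b = A' \<times> B'"
      by auto
    then have "A \<inter> A' \<in> G" "B \<inter> B' \<in> H"
      using G H by (auto simp: countable_pi_generator_def Int_stable_def)
    moreover have "a \<inter> b = (A \<inter> A') \<times> (B \<inter> B')" using ab by auto
    ultimately show "a \<inter> b \<in> ?GH" by auto
  qed
  moreover have "space (M \<Otimes>\<^sub>M N) \<in> ?GH"
    using G H by (auto simp: countable_pi_generator_def space_pair_measure)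
  moreover have sub: "?GH \<subseteq> Pow (space (M \<Otimes>\<^sub>M N))"
    using G H by (auto simp: countable_pi_generator_def space_pair_measure)
  moreover have "sets (M \<Otimes>\<^sub>M N) = sigma_sets (space (M \<Otimes>\<^sub>M N)) ?GH"
  proof -
    have eq: "?GH = {a \<times> b | a b. a \<in> G \<and> b \<in> H}" by auto
    have "sets (M \<Otimes>\<^sub>M N) = sets (sigma (space M \<times> space N) {a \<times> b | a b. a \<in> G \<and> b \<in> H})"
      using G H by (intro sets_pair_eq[where Ca = "{space M}" and Cb = "{space N}"])
        (auto simp: countable_pi_generator_def)
    also have "\<dots> = sigma_sets (space (M \<Otimes>\<^sub>M N)) ?GH"
      unfolding eq[symmetric] using sub by (subst sets_measure_of) (auto simp: space_pair_measure)
    finally show ?thesis .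
  qed
  ultimately show ?thesis by (simp add: countable_pi_generator_def)
qed

text \<open>The sets over which \<open>f - g\<close> integrates to zero form a Dynkin system.\<close>

lemma AE_eq_if_integrals_agree_on_generator:
  fixes f g :: "'a \<Rightarrow> real"
  assumes G: "countable_pi_generator M G" and f: "integrable M f" and g: "integrable M g"
    and eq: "\<And>A. A \<in> G \<Longrightarrow> (\<integral>x. f x * indicator A x \<partial>M) = (\<integral>x. g x * indicator A x \<partial>M)"
  shows "AE x in M. f x = g x"
proof -
  define u where "u x = f x - g x" for x
  have u: "integrable M u" unfolding u_def using f g by simp
  have ind: "integrable M (\<lambda>x. h x * indicator A x)" if "integrable M h" "A \<in> sets M"
    for h :: "'a \<Rightarrow> real" and A
    using integrable_real_mult_indicator[OF that(2) that(1)] .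
  have sets_eq: "sets M = sigma_sets (space M) G" and "Int_stable G" "G \<subseteq> Pow (space M)"
    and spG: "space M \<in> G"
    using G by (auto simp: countable_pi_generator_def)
  have u0: "(\<integral>x. u x * indicator A x \<partial>M) = 0" if "A \<in> G" for A
  proof -
    have "A \<in> sets M" using that G by (rule countable_pi_generator_in_sets[rotated])
    then have "(\<integral>x. u x * indicator A x \<partial>M)
        = (\<integral>x. f x * indicator A x \<partial>M) - (\<integral>x. g x * indicator A x \<partial>M)"
      unfolding u_def left_diff_distrib using f g by (intro Bochner_Integration.integral_diff ind)
    then show ?thesis using eq[OF that] by simp
  qed
  have int_u: "(\<integral>x. u x \<partial>M) = 0"
  proof -
    have "(\<integral>x. u x \<partial>M) = (\<integral>x. u x * indicator (space M) x \<partial>M)"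
      by (intro Bochner_Integration.integral_cong) auto
    then show ?thesis using u0[OF spG] by simp
  qed
  have all: "(\<integral>x. u x * indicator A x \<partial>M) = 0" if "A \<in> sets M" for A
    using \<open>Int_stable G\<close> \<open>G \<subseteq> Pow (space M)\<close> that[unfolded sets_eq]
  proof (induction rule: sigma_sets_induct_disjoint)
    case (basic A) then show ?case by (rule u0)
  next
    case empty show ?case by simp
  next
    case (compl A)
    have A: "A \<in> sets M" using compl(1) sets_eq by simp
    have "(\<integral>x. u x * indicator (space M - A) x \<partial>M) = (\<integral>x. u x - u x * indicator A x \<partial>M)"
      by (intro Bochner_Integration.integral_cong) (auto simp: indicator_def)
    also have "\<dots> = 0"
      using u A ind[OF u A] int_u compl by (subst Bochner_Integration.integral_diff) auto
    finally show ?case .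
  next
    case (union A)
    have A: "range A \<subseteq> sets M" using union sets_eq by auto
    have "(LINT x:(\<Union>i. A i)|M. u x) = (\<Sum>i. (LINT x:A i|M. u x))"
    proof (rule lebesgue_integral_countable_add)
      show "A i \<in> sets M" for i using A by auto
      show "\<And>i j. i \<noteq> j \<Longrightarrow> A i \<inter> A j = {}" using union(1) by (auto simp: disjoint_family_on_def)
      show "set_integrable M (\<Union>i. A i) u"
        using A u unfolding set_integrable_def
        by (intro integrable_mult_indicator) (auto intro!: sets.countable_UN)
    qed
    also have "\<dots> = 0" using union by (simp add: set_lebesgue_integral_def mult.commute)
    finally show ?case by (simp add: set_lebesgue_integral_def mult.commute)
  qed
  have "AE x in M. u x = 0"
    using u all by (intro density_unique_real) (auto simp: set_lebesgue_integral_def mult.commute)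
  then show ?thesis by (simp add: u_def)
qed

section \<open>Set functions dominated by a measure\<close>

text \<open>Such an \<open>a\<close> stands for \<open>A \<mapsto> \<integral> f 1\<^sub>A\<close> with a density \<open>0 \<le> f \<le> K\<close>. Working with set functions
  avoids choosing densities before a limit has been taken: additivity and the bound pass to
  pointwise limits, and countable additivity follows from the bound.\<close>

definition dominated_additive :: "'a measure \<Rightarrow> real \<Rightarrow> ('a set \<Rightarrow> real) \<Rightarrow> bool" where
  "dominated_additive M K a \<longleftrightarrow>
     (\<forall>A\<in>sets M. 0 \<le> a A \<and> a A \<le> K * measure M A) \<and>
     (\<forall>A\<in>sets M. \<forall>B\<in>sets M. A \<inter> B = {} \<longrightarrow> a (A \<union> B) = a A + a B)"

lemma dominated_additiveD:
  assumes "dominated_additive M K a"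
  shows "A \<in> sets M \<Longrightarrow> 0 \<le> a A" "A \<in> sets M \<Longrightarrow> a A \<le> K * measure M A"
    "A \<in> sets M \<Longrightarrow> B \<in> sets M \<Longrightarrow> A \<inter> B = {} \<Longrightarrow> a (A \<union> B) = a A + a B"
  using assms by (auto simp: dominated_additive_def)

text \<open>Domination by \<open>K m\<close> gives continuity at the empty set, hence countable additivity, as well as
  absolute continuity; the Radon-Nikodym density is then at most \<open>K\<close> almost everywhere and can be
  truncated to satisfy the bounds at every point.\<close>

lemma (in finite_measure) dominated_additive_density:
  assumes a: "dominated_additive M K a" and K: "0 \<le> K"
  obtains f where "f \<in> borel_measurable M" "\<And>x. 0 \<le> f x" "\<And>x. f x \<le> K"
    "\<And>A. A \<in> sets M \<Longrightarrow> a A = (\<integral>x. f x * indicator A x \<partial>M)"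
proof -
  note a = dominated_additiveD[OF a]
  define N where "N = measure_of (space M) (sets M) (\<lambda>A. ennreal (a A))"
  have a_empty: "a {} = 0" using a(1,2)[of "{}"] by simp
  have pos: "positive (sets M) (\<lambda>A. ennreal (a A))"
    by (simp add: positive_def a_empty)
  have "countably_additive (sets M) (\<lambda>A. ennreal (a A))"
  proof (rule sets.empty_continuous_imp_countably_additive[OF pos])
    show "additive (sets M) (\<lambda>A. ennreal (a A))"
      using a by (auto simp: additive_def ennreal_plus[symmetric] simp del: ennreal_plus)
    show "\<forall>A\<in>sets M. ennreal (a A) \<noteq> \<infinity>" by simp
    fix B :: "nat \<Rightarrow> 'a set"
    assume B: "range B \<subseteq> sets M" "decseq B" "(\<Inter>i. B i) = {}"
    have "(\<lambda>i. K * measure M (B i)) \<longlonglongrightarrow> K * measure M (\<Inter>i. B i)"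
      using B by (intro tendsto_mult_left finite_Lim_measure_decseq)
    then have "(\<lambda>i. K * measure M (B i)) \<longlonglongrightarrow> 0" using B by simp
    then have "(\<lambda>i. a (B i)) \<longlonglongrightarrow> 0"
      using a(1,2) B(1)
      by (intro real_tendsto_sandwich[where f = "\<lambda>_. 0" and g = "\<lambda>i. a (B i)"]) auto
    then show "(\<lambda>i. ennreal (a (B i))) \<longlonglongrightarrow> 0"
      using tendsto_ennrealI by fastforce
  qed
  then have N: "emeasure N A = ennreal (a A)" if "A \<in> sets M" for A
    unfolding N_def using that pos
    by (intro emeasure_measure_of_sigma sets.sigma_algebra_axioms) auto
  have sets_N: "sets N = sets M" and space_N: "space N = space M"
    unfolding N_def by (auto simp: sets.space_closed)
  interpret N: finite_measure N
    by (rule finite_measureI) (simp add: N space_N)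
  have ac: "absolutely_continuous M N"
    unfolding absolutely_continuous_def
  proof
    fix A assume A: "A \<in> null_sets M"
    then have "a A = 0" using a(1,2)[of A] by (auto simp: null_sets_def measure_def)
    then show "A \<in> null_sets N" using A N sets_N by (auto simp: null_sets_def)
  qed
  define D where "D = RN_deriv M N"
  have [measurable]: "D \<in> borel_measurable M" by (simp add: D_def)
  have dens: "density M D = N" unfolding D_def by (rule density_RN_deriv[OF ac sets_N])
  have nnD: "(\<integral>\<^sup>+x. D x * indicator A x \<partial>M) = ennreal (a A)" if "A \<in> sets M" for A
    using N[OF that] that unfolding dens[symmetric] by (simp add: emeasure_density)
  have le: "AE x in M. D x \<le> ennreal K"
  proof -
    define B where "B = {x \<in> space M. ennreal K < D x}"
    have B[measurable]: "B \<in> sets M" unfolding B_def by measurable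
    have fin: "(\<integral>\<^sup>+x. ennreal K * indicator B x \<partial>M) \<noteq> \<infinity>"
      by (simp add: nn_integral_cmult_indicator ennreal_mult_eq_top_iff)
    show ?thesis
    proof (rule ccontr)
      assume "\<not> ?thesis"
      then have nB: "emeasure M B \<noteq> 0"
        by (subst (asm) AE_iff_measurable[OF B]) (auto simp: B_def not_le)
      have "(\<integral>\<^sup>+x. ennreal K * indicator B x \<partial>M) < (\<integral>\<^sup>+x. D x * indicator B x \<partial>M)"
      proof (rule nn_integral_less)
        show "AE x in M. ennreal K * indicator B x \<le> D x * indicator B x"
          by (auto simp: B_def indicator_def)
        show "\<not> (AE x in M. D x * indicator B x \<le> ennreal K * indicator B x)"
        proof
          assume "AE x in M. D x * indicator B x \<le> ennreal K * indicator B x"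
          then have "AE x in M. x \<notin> B"
            by eventually_elim (auto simp: B_def indicator_def split: if_splits)
          then show False using nB AE_iff_measurable[OF B, of "\<lambda>x. x \<notin> B"] sets.sets_into_space[OF B]
            by auto
        qed
      qed (use fin in auto)
      also have "\<dots> \<le> ennreal (K * measure M B)" using nnD[OF B] a(2)[OF B] by (simp add: ennreal_leI)
      also have "\<dots> = (\<integral>\<^sup>+x. ennreal K * indicator B x \<partial>M)"
        using K by (simp add: nn_integral_cmult_indicator ennreal_mult emeasure_eq_measure)
      finally show False by simp
    qed
  qed
  define f where "f x = enn2real (min (D x) (ennreal K))" for x
  show ?thesis
  proof
    show f[measurable]: "f \<in> borel_measurable M" unfolding f_def by measurable
    show f0: "0 \<le> f x" for x by (simp add: f_def)
    show fK: "f x \<le> K" for x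
      unfolding f_def using K by (intro enn2real_leI) auto
    fix A assume A[measurable]: "A \<in> sets M"
    have "(\<integral>\<^sup>+x. ennreal (f x * indicator A x) \<partial>M) = (\<integral>\<^sup>+x. D x * indicator A x \<partial>M)"
    proof (intro nn_integral_cong_AE)
      show "AE x in M. ennreal (f x * indicator A x) = D x * indicator A x"
        using le
      proof eventually_elim
        case (elim x)
        then have "ennreal (f x) = D x"
          unfolding f_def by (simp add: min_absorb1 less_le_trans[of _ "ennreal K"] le_less_trans[of _ "ennreal K" top])
        then show ?case by (auto simp: indicator_def)
      qed
    qed
    also have "\<dots> = ennreal (a A)" by (rule nnD[OF A])
    finally show "a A = (\<integral>x. f x * indicator A x \<partial>M)"
      using f0 a(1)[OF A] by (subst integral_eq_nn_integral) auto
  qed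
qed

lemma diagonal_subsequence:
  fixes a :: "nat \<Rightarrow> 'b \<Rightarrow> real"
  assumes "countable G" and bdd: "\<And>A. A \<in> G \<Longrightarrow> bounded (range (\<lambda>n. a n A))"
  obtains r where "strict_mono r" "\<And>A. A \<in> G \<Longrightarrow> convergent (\<lambda>n. a (r n) A)"
proof (cases "G = {}")
  case True
  then show ?thesis using that[of id] by (simp add: strict_mono_id)
next
  case False
  define e where "e = from_nat_into G"
  have e: "range e = G" unfolding e_def using range_from_nat_into[OF False \<open>countable G\<close>] .
  let ?P = "\<lambda>n s. convergent (\<lambda>k. a (s k) (e n))"
  interpret subseqs ?P
  proof
    fix n :: nat and s :: "nat \<Rightarrow> nat" assume "strict_mono s"
    have "bounded (range (\<lambda>k. a (s k) (e n)))"
      by (rule bounded_subset[OF bdd[of "e n"]]) (use e in auto)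
    then obtain l r where "strict_mono (r :: nat \<Rightarrow> nat)" "((\<lambda>k. a (s k) (e n)) \<circ> r) \<longlonglongrightarrow> l"
      using bounded_imp_convergent_subsequence by blast
    then show "\<exists>r'. strict_mono r' \<and> convergent (\<lambda>k. a ((s \<circ> r') k) (e n))"
      by (auto simp: o_def convergent_def)
  qed
  have "convergent (\<lambda>k. a (diagseq k) (e n))" for n
  proof -
    have "?P n (diagseq \<circ> ((+) (Suc n)))"
    proof (rule diagseq_holds)
      fix r s :: "nat \<Rightarrow> nat" and n assume "strict_mono r" "convergent (\<lambda>k. a (s k) (e n))"
      then show "convergent (\<lambda>k. a ((s \<circ> r) k) (e n))"
        using convergent_subseq_convergent[of "\<lambda>k. a (s k) (e n)" r] by (simp add: o_def)
    qed
    then have "convergent (\<lambda>k. a (diagseq (k + Suc n)) (e n))" by (simp add: o_def add.commute)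
    then show ?thesis
      using convergent_ignore_initial_segment[of "\<lambda>k. a (diagseq k) (e n)" "Suc n"] by simp
  qed
  then show ?thesis using that[OF subseq_diagseq] e by (metis imageE)
qed

text \<open>Convergence passes to countable disjoint unions because the tail of the union contributes at
  most \<open>K\<close> times its measure, uniformly in \<open>n\<close>.\<close>

lemma (in finite_measure) dominated_additive_convergent:
  fixes a :: "nat \<Rightarrow> 'a set \<Rightarrow> real"
  assumes G: "countable_pi_generator M G" and a: "\<And>n. dominated_additive M K (a n)"
    and conv: "\<And>A. A \<in> G \<Longrightarrow> convergent (\<lambda>n. a n A)" and A: "A \<in> sets M"
  shows "convergent (\<lambda>n. a n A)"
proof -
  note a = dominated_additiveD[OF a]
  have sets_eq: "sets M = sigma_sets (space M) G" and "Int_stable G" "G \<subseteq> Pow (space M)"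
    and spG: "space M \<in> G"
    using G by (auto simp: countable_pi_generator_def)
  have a_empty: "a n {} = 0" for n using a(1,2)[of "{}" n] by simp
  show ?thesis
    using \<open>Int_stable G\<close> \<open>G \<subseteq> Pow (space M)\<close> A[unfolded sets_eq]
  proof (induction rule: sigma_sets_induct_disjoint)
    case (basic A) then show ?case by (rule conv)
  next
    case empty show ?case by (simp add: a_empty convergent_const)
  next
    case (compl A)
    have A: "A \<in> sets M" using compl sets_eq by simp
    have "a n (space M - A) = a n (space M) - a n A" for n
    proof -
      have "A \<union> (space M - A) = space M" using sets.sets_into_space[OF A] by auto
      then show ?thesis using a(3)[of A "space M - A" n] A by auto
    qed
    then show ?case using convergent_diff[OF conv[OF spG] compl(2)] by simp
  next
    case (union B)
    have B: "B i \<in> sets M" for i using union sets_eq by auto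
    define U where "U N = (\<Union>i<N. B i)" for N
    have U: "U N \<in> sets M" for N unfolding U_def using B by auto
    have aU: "a n (U N) = (\<Sum>i<N. a n (B i))" for n N
    proof (induction N)
      case 0 then show ?case by (simp add: U_def a_empty)
    next
      case (Suc N)
      have "U (Suc N) = U N \<union> B N" by (auto simp: U_def less_Suc_eq)
      moreover have "B i \<inter> B N = {}" if "i < N" for i
        using union(1) that by (simp add: disjoint_family_on_def)
      then have "U N \<inter> B N = {}" by (auto simp: U_def)
      ultimately show ?case using Suc a(3)[OF U B] by simp
    qed
    let ?V = "\<lambda>N. (\<Union>i. B i) - U N"
    have V: "?V N \<in> sets M" for N using B U by auto
    have split: "a n (\<Union>i. B i) = a n (U N) + a n (?V N)" for n N
    proof -
      have "U N \<union> ?V N = (\<Union>i. B i)" by (auto simp: U_def)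
      then show ?thesis using a(3)[OF U V, of N N n] by auto
    qed
    have "(\<Inter>N. ?V N) = {}" by (auto simp: U_def)
    moreover have "(\<lambda>N. K * measure M (?V N)) \<longlonglongrightarrow> K * measure M (\<Inter>N. ?V N)"
      using V by (intro tendsto_mult_left finite_Lim_measure_decseq)
        (force simp: U_def decseq_def)+
    ultimately have tail: "(\<lambda>N. K * measure M (?V N)) \<longlonglongrightarrow> 0"
      by (simp only: measure_empty mult_zero_right)
    have "Cauchy (\<lambda>n. a n (\<Union>i. B i))"
    proof (rule metric_CauchyI)
      fix e :: real assume "0 < e"
      then obtain N where N: "K * measure M (?V N) < e / 3"
        using order_tendstoD(2)[OF tail, of "e / 3"] by (auto simp: eventually_sequentially)
      have "convergent (\<lambda>n. a n (U N))"
        unfolding aU using union(3) by (intro convergent_sum) auto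
      then have "Cauchy (\<lambda>n. a n (U N))" by (rule convergent_Cauchy)
      then obtain n0 where n0: "\<And>m n. m \<ge> n0 \<Longrightarrow> n \<ge> n0 \<Longrightarrow> dist (a m (U N)) (a n (U N)) < e / 3"
        using \<open>0 < e\<close> by (metis metric_CauchyD zero_less_divide_iff zero_less_numeral)
      have "dist (a m (\<Union>i. B i)) (a n (\<Union>i. B i)) < e" if "m \<ge> n0" "n \<ge> n0" for m n
        using n0[OF that] a(1)[OF V, of m N] a(1)[OF V, of n N] a(2)[OF V, of m N] a(2)[OF V, of n N] N
        unfolding split[of m N] split[of n N] dist_real_def by linarith
      then show "\<exists>n0. \<forall>m\<ge>n0. \<forall>n\<ge>n0. dist (a m (\<Union>i. B i)) (a n (\<Union>i. B i)) < e" by blast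
    qed
    then show ?case by (simp add: Cauchy_convergent_iff)
  qed
qed

text \<open>Sequential compactness of the order interval \<open>[0, K]\<close> of densities under setwise
  convergence.\<close>

lemma (in finite_measure) dominated_additive_compact:
  fixes a :: "nat \<Rightarrow> 'a set \<Rightarrow> real"
  assumes G: "countable_pi_generator M G" and a: "\<And>n. dominated_additive M K (a n)"
    and K: "0 \<le> K"
  obtains r f where "strict_mono r" "f \<in> borel_measurable M" "\<And>x. 0 \<le> f x" "\<And>x. f x \<le> K"
    "\<And>A. A \<in> sets M \<Longrightarrow> (\<lambda>n. a (r n) A) \<longlonglongrightarrow> (\<integral>x. f x * indicator A x \<partial>M)"
proof -
  note aD = dominated_additiveD[OF a]
  have "countable G" using G by (simp add: countable_pi_generator_def)
  moreover have "bounded (range (\<lambda>n. a n A))" if "A \<in> G" for A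
  proof -
    have "A \<in> sets M" using G that by (rule countable_pi_generator_in_sets)
    then show ?thesis
      using aD(1,2)[of A] by (intro bounded_subset[OF bounded_closed_interval[of 0 "K * measure M A"]]) auto
  qed
  ultimately obtain r where r: "strict_mono r" "\<And>A. A \<in> G \<Longrightarrow> convergent (\<lambda>n. a (r n) A)"
    by (rule diagonal_subsequence[of G a]) auto
  define L where "L A = lim (\<lambda>n. a (r n) A)" for A
  have L: "(\<lambda>n. a (r n) A) \<longlonglongrightarrow> L A" if "A \<in> sets M" for A
    unfolding L_def convergent_LIMSEQ_iff[symmetric]
    by (rule dominated_additive_convergent[OF G a r(2) that])
  have dom: "dominated_additive M K L"
    unfolding dominated_additive_def
  proof (intro conjI ballI impI)
    fix A assume A: "A \<in> sets M"
    show "0 \<le> L A" by (rule LIMSEQ_le_const[OF L[OF A]]) (use aD(1)[OF A] in auto)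
    show "L A \<le> K * measure M A"
      by (rule LIMSEQ_le_const2[OF L[OF A]]) (use aD(2)[OF A] in auto)
    fix B assume B: "B \<in> sets M" "A \<inter> B = {}"
    show "L (A \<union> B) = L A + L B"
      using LIMSEQ_unique[OF L[of "A \<union> B"], of "L A + L B"] tendsto_add[OF L[OF A] L[OF B(1)]]
        aD(3)[OF A B] A B by auto
  qed
  show ?thesis
  proof (rule dominated_additive_density[OF dom K])
    fix f assume "f \<in> borel_measurable M" "\<And>x. 0 \<le> f x" "\<And>x. f x \<le> K"
      "\<And>A. A \<in> sets M \<Longrightarrow> L A = (\<integral>x. f x * indicator A x \<partial>M)"
    then show thesis using L by (intro that[OF r(1), of f]) simp_all
  qed
qed


section \<open>Weak compactness in \<open>L\<^sup>1\<close>\<close>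

lemma L1_functional_add:
  assumes "L1_functional M \<Lambda>" "integrable M f" "integrable M g"
  shows "\<Lambda> (\<lambda>x. f x + g x) = \<Lambda> f + \<Lambda> g"
  using assms(1)[unfolded L1_functional_def, THEN conjunct1, rule_format, OF assms(2,3)] .

lemma L1_functional_scale:
  assumes "L1_functional M \<Lambda>" "integrable M f"
  shows "\<Lambda> (\<lambda>x. c * f x) = c * \<Lambda> f"
  using assms(1)[unfolded L1_functional_def, THEN conjunct2, THEN conjunct1, rule_format, OF assms(2)] .

lemma L1_functional_bound:
  assumes "L1_functional M \<Lambda>"
  obtains K where "0 \<le> K"
    "\<And>f g. integrable M f \<Longrightarrow> integrable M g \<Longrightarrow> \<bar>\<Lambda> f - \<Lambda> g\<bar> \<le> K * (\<integral>x. \<bar>f x - g x\<bar> \<partial>M)"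
proof -
  obtain K where K: "\<And>f. integrable M f \<Longrightarrow> \<bar>\<Lambda> f\<bar> \<le> K * (\<integral>x. \<bar>f x\<bar> \<partial>M)"
    using assms[unfolded L1_functional_def, THEN conjunct2, THEN conjunct2] by blast
  show ?thesis
  proof
    show "0 \<le> max K 0" by simp
    fix f g :: "'a \<Rightarrow> real" assume f: "integrable M f" and g: "integrable M g"
    have "\<Lambda> (\<lambda>x. (f x - g x) + g x) = \<Lambda> (\<lambda>x. f x - g x) + \<Lambda> g"
      using L1_functional_add[OF assms Bochner_Integration.integrable_diff[OF f g] g] .
    then have "\<bar>\<Lambda> f - \<Lambda> g\<bar> = \<bar>\<Lambda> (\<lambda>x. f x - g x)\<bar>" by simp
    also have "\<dots> \<le> K * (\<integral>x. \<bar>f x - g x\<bar> \<partial>M)" using f g by (intro K) simp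
    also have "\<dots> \<le> max K 0 * (\<integral>x. \<bar>f x - g x\<bar> \<partial>M)" by (intro mult_right_mono) auto
    finally show "\<bar>\<Lambda> f - \<Lambda> g\<bar> \<le> max K 0 * (\<integral>x. \<bar>f x - g x\<bar> \<partial>M)" .
  qed
qed

lemma tendsto_L1_dominated:
  fixes f :: "'a \<Rightarrow> real"
  assumes s: "\<And>i. integrable M (s i)" and f: "integrable M f"
    and lim: "\<And>x. x \<in> space M \<Longrightarrow> (\<lambda>i. s i x) \<longlonglongrightarrow> f x"
    and bd: "\<And>i x. x \<in> space M \<Longrightarrow> norm (s i x) \<le> 2 * norm (f x)"
  shows "(\<lambda>i. \<integral>x. \<bar>s i x - f x\<bar> \<partial>M) \<longlonglongrightarrow> 0"
proof -
  have "(\<lambda>i. \<integral>x. \<bar>s i x - f x\<bar> \<partial>M) \<longlonglongrightarrow> (\<integral>x. 0 \<partial>M)"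
  proof (rule integral_dominated_convergence[where w = "\<lambda>x. 3 * \<bar>f x\<bar>"])
    show "AE x in M. (\<lambda>i. \<bar>s i x - f x\<bar>) \<longlonglongrightarrow> 0"
    proof (rule AE_I2)
      fix x assume "x \<in> space M"
      then have "(\<lambda>i. \<bar>s i x - f x\<bar>) \<longlonglongrightarrow> \<bar>f x - f x\<bar>" by (intro tendsto_intros lim)
      then show "(\<lambda>i. \<bar>s i x - f x\<bar>) \<longlonglongrightarrow> 0" by simp
    qed
    show "AE x in M. norm \<bar>s i x - f x\<bar> \<le> 3 * \<bar>f x\<bar>" for i
      
    proof (rule AE_I2)
      fix x assume "x \<in> space M"
      from bd[OF this, of i] show "norm \<bar>s i x - f x\<bar> \<le> 3 * \<bar>f x\<bar>" by simp
    qed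
  qed (use s f in \<open>auto\<close>)
  then show ?thesis by simp
qed

lemma (in finite_measure) integrable_mult_bounded:
  fixes f g :: "'a \<Rightarrow> real"
  assumes "integrable M f" "g \<in> borel_measurable M" "AE x in M. \<bar>g x\<bar> \<le> K"
  shows "integrable M (\<lambda>x. f x * g x)"
proof (rule Bochner_Integration.integrable_bound[where f = "\<lambda>x. K * f x"])
  show "AE x in M. norm (f x * g x) \<le> norm (K * f x)"
    using assms(3)
  proof eventually_elim
    case (elim x)
    have "\<bar>f x\<bar> * \<bar>g x\<bar> \<le> \<bar>f x\<bar> * \<bar>K\<bar>" using elim by (intro mult_left_mono) auto
    then show ?case by (simp add: abs_mult mult.commute)
  qed
qed (use assms in auto)

lemma (in finite_measure) integral_diff_mult_bounded:
  fixes f g u :: "'a \<Rightarrow> real"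
  assumes f: "integrable M f" and g: "integrable M g"
    and u: "u \<in> borel_measurable M" "AE x in M. \<bar>u x\<bar> \<le> K"
  shows "\<bar>(\<integral>x. f x * u x \<partial>M) - (\<integral>x. g x * u x \<partial>M)\<bar> \<le> K * (\<integral>x. \<bar>f x - g x\<bar> \<partial>M)"
proof -
  note i = integrable_mult_bounded[OF f u] integrable_mult_bounded[OF g u]
  have "(\<integral>x. f x * u x \<partial>M) - (\<integral>x. g x * u x \<partial>M) = (\<integral>x. (f x - g x) * u x \<partial>M)"
    using i by (simp add: left_diff_distrib)
  also have "\<bar>\<dots>\<bar> \<le> (\<integral>x. \<bar>(f x - g x) * u x\<bar> \<partial>M)"
    by (rule integral_abs_bound)
  also have "\<dots> \<le> (\<integral>x. K * \<bar>f x - g x\<bar> \<partial>M)"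
  proof (rule integral_mono_AE)
    show "integrable M (\<lambda>x. \<bar>(f x - g x) * u x\<bar>)" using i by (simp add: left_diff_distrib)
    show "AE x in M. \<bar>(f x - g x) * u x\<bar> \<le> K * \<bar>f x - g x\<bar>"
      using u(2) by eventually_elim (simp add: abs_mult mult.commute mult_right_mono)
  qed (use f g in auto)
  finally show ?thesis by simp
qed

text \<open>The dual of \<open>L\<^sup>1\<close> is \<open>L\<^sup>\<infinity>\<close>. If \<open>K\<close> bounds the norm of \<open>\<Lambda>\<close>, the set function
  \<open>A \<mapsto> \<Lambda> 1\<^sub>A + K m(A)\<close> lies between \<open>0\<close> and \<open>2 K m(A)\<close>, so it has a bounded density, from
  which subtracting \<open>K\<close> leaves the representing function.\<close>

lemma (in finite_measure) L1_functional_representation: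
  assumes \<Lambda>: "L1_functional M \<Lambda>"
  obtains g K where "g \<in> borel_measurable M" "\<And>x. \<bar>g x\<bar> \<le> K"
    "\<And>f. integrable M f \<Longrightarrow> \<Lambda> f = (\<integral>x. f x * g x \<partial>M)"
proof -
  obtain K where K: "0 \<le> K"
    "\<And>f g. integrable M f \<Longrightarrow> integrable M g \<Longrightarrow> \<bar>\<Lambda> f - \<Lambda> g\<bar> \<le> K * (\<integral>x. \<bar>f x - g x\<bar> \<partial>M)"
    using L1_functional_bound[OF \<Lambda>] by metis
  note add = L1_functional_add[OF \<Lambda>] and scale = L1_functional_scale[OF \<Lambda>]
  have \<Lambda>0: "\<Lambda> (\<lambda>x. 0) = 0" using scale[of "\<lambda>x. 0" 0] by simp
  have bound: "\<bar>\<Lambda> (indicator A)\<bar> \<le> K * measure M A" if "A \<in> sets M" for A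
    using K(2)[of "indicator A" "\<lambda>x. 0"] that \<Lambda>0 by (simp add: less_top[symmetric])
  define a where "a A = \<Lambda> (indicator A) + K * measure M A" for A
  have "dominated_additive M (2 * K) a"
    unfolding dominated_additive_def
  proof (intro conjI ballI impI)
    fix A assume A: "A \<in> sets M"
    show "0 \<le> a A" "a A \<le> 2 * K * measure M A" using bound[OF A] by (auto simp: a_def)
    fix B assume B: "B \<in> sets M" "A \<inter> B = {}"
    have "indicator (A \<union> B) = (\<lambda>x. indicator A x + indicator B x :: real)"
      using B by (auto simp: indicator_def fun_eq_iff)
    then have "\<Lambda> (indicator (A \<union> B)) = \<Lambda> (indicator A) + \<Lambda> (indicator B)"
      using A B by (simp add: add less_top[symmetric])
    then show "a (A \<union> B) = a A + a B"
      using finite_measure_Union[OF A B] by (simp add: a_def algebra_simps)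
  qed
  then obtain f0 where f0: "f0 \<in> borel_measurable M" "\<And>x. 0 \<le> f0 x" "\<And>x. f0 x \<le> 2 * K"
    "\<And>A. A \<in> sets M \<Longrightarrow> a A = (\<integral>x. f0 x * indicator A x \<partial>M)"
    using dominated_additive_density[of "2 * K" a] K(1) by auto
  define g where "g x = f0 x - K" for x
  have g: "g \<in> borel_measurable M" unfolding g_def using f0 by simp
  have gK: "\<bar>g x\<bar> \<le> K" for x using f0(2,3)[of x] by (auto simp: g_def)
  have int: "integrable M (\<lambda>x. f x * g x)" if "integrable M f" for f
    using integrable_mult_bounded[OF that g] gK by auto
  have "\<Lambda> f = (\<integral>x. f x * g x \<partial>M)" if "integrable M f" for f
    using that
  proof (induction rule: integrable_induct)
    case (base A c)
    have i: "integrable M (indicator A :: 'a \<Rightarrow> real)" using base by (simp add: less_top[symmetric])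
    have if0: "integrable M (\<lambda>x. f0 x * indicator A x)"
      using integrable_mult_bounded[OF i f0(1), of "2 * K"] f0(2,3) by (simp add: mult.commute)
    have "\<Lambda> (\<lambda>x. indicator A x *\<^sub>R c) = c * \<Lambda> (indicator A)"
      using scale[OF i, of c] by (simp add: mult.commute)
    also have "\<Lambda> (indicator A) = (\<integral>x. f0 x * indicator A x \<partial>M) - K * measure M A"
      using f0(4)[OF base(1)] by (simp add: a_def)
    also have "\<dots> = (\<integral>x. f0 x * indicator A x - K * indicator A x \<partial>M)"
      using if0 i base by (subst Bochner_Integration.integral_diff) auto
    also have "c * \<dots> = (\<integral>x. c * (f0 x * indicator A x - K * indicator A x) \<partial>M)"
      by (rule integral_mult_right_zero[symmetric])
    also have "\<dots> = (\<integral>x. indicator A x *\<^sub>R c * g x \<partial>M)"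
      by (intro Bochner_Integration.integral_cong) (auto simp: g_def algebra_simps)
    finally show ?case .
  next
    case (add f g)
    then show ?case by (simp add: L1_functional_add[OF \<Lambda>]      distrib_right int)
  next
    case (lim f s)
    have z: "(\<lambda>i. K * (\<integral>x. \<bar>s i x - f x\<bar> \<partial>M)) \<longlonglongrightarrow> 0"
      using tendsto_mult_left[OF tendsto_L1_dominated[OF lim.hyps(1) lim.hyps(4) lim.hyps(2) lim.hyps(3)], of K] by simp
    have "(\<lambda>i. \<Lambda> (s i) - \<Lambda> f) \<longlonglongrightarrow> 0"
      using K(2)[OF lim.hyps(1) lim.hyps(4)] by (intro Lim_null_comparison[OF _ z]) simp
    then have "(\<lambda>i. \<Lambda> (s i)) \<longlonglongrightarrow> \<Lambda> f" by (rule LIM_zero_cancel)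
    moreover have "(\<lambda>i. (\<integral>x. s i x * g x \<partial>M) - (\<integral>x. f x * g x \<partial>M)) \<longlonglongrightarrow> 0"
      using integral_diff_mult_bounded[OF lim.hyps(1) lim.hyps(4) g, of K] gK
      by (intro Lim_null_comparison[OF _ z]) simp
    then have "(\<lambda>i. \<integral>x. s i x * g x \<partial>M) \<longlonglongrightarrow> (\<integral>x. f x * g x \<partial>M)"
      by (rule LIM_zero_cancel)
    ultimately show ?case using lim.IH LIMSEQ_unique by auto
  qed
  then show ?thesis using that[OF g gK] by blast
qed

text \<open>Under a uniform bound on the \<open>u n\<close>, convergence of integrals against indicators extends to all
  integrable test functions by density, in particular to the bounded ones that represent the
  functionals on \<open>L\<^sup>1\<close>.\<close>

lemma (in finite_measure) weakly_converges_L1I: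
  assumes u: "\<And>n. u n \<in> borel_measurable M" "\<And>n. AE x in M. \<bar>u n x\<bar> \<le> K"
    and f: "f \<in> borel_measurable M" "AE x in M. \<bar>f x\<bar> \<le> K"
    and lim: "\<And>A. A \<in> sets M \<Longrightarrow>
      (\<lambda>n. \<integral>x. u n x * indicator A x \<partial>M) \<longlonglongrightarrow> (\<integral>x. f x * indicator A x \<partial>M)"
  shows "weakly_converges_L1 M u f"
  unfolding weakly_converges_L1_def
proof (intro allI impI)
  fix \<Lambda> assume "L1_functional M \<Lambda>"
  then obtain g B where g: "g \<in> borel_measurable M" "\<And>x. \<bar>g x\<bar> \<le> B"
    and \<Lambda>: "\<And>f. integrable M f \<Longrightarrow> \<Lambda> f = (\<integral>x. f x * g x \<partial>M)"
    by (rule L1_functional_representation) blast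
  have int: "integrable M h" if "h \<in> borel_measurable M" "AE x in M. \<bar>h x\<bar> \<le> c" for h :: "'a \<Rightarrow> real" and c
    using that by (intro integrable_const_bound) auto
  have "integrable M g" using int[OF g(1), of B] g(2) by simp
  then have "(\<lambda>n. \<integral>x. g x * u n x \<partial>M) \<longlonglongrightarrow> (\<integral>x. g x * f x \<partial>M)"
  proof (induction rule: integrable_induct)
    case (base A c)
    have eq: "(\<integral>x. indicator A x *\<^sub>R c * h x \<partial>M) = c * (\<integral>x. h x * indicator A x \<partial>M)" for h
    proof -
      have "(\<integral>x. indicator A x *\<^sub>R c * h x \<partial>M) = (\<integral>x. c * (h x * indicator A x) \<partial>M)"
        by (intro Bochner_Integration.integral_cong) auto
      then show ?thesis by simp
    qed
    show ?case unfolding eq by (intro tendsto_mult_left lim base)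
  next
    case (add g h)
    then show ?case
      using integrable_mult_bounded[OF add.hyps(1) u] integrable_mult_bounded[OF add.hyps(2) u]
        integrable_mult_bounded[OF add.hyps(1) f] integrable_mult_bounded[OF add.hyps(2) f]
      by (simp add: distrib_right tendsto_add)
  next
    case (lim g s)
    define d where "d i = K * (\<integral>x. \<bar>s i x - g x\<bar> \<partial>M)" for i
    have z: "d \<longlonglongrightarrow> 0"
      unfolding d_def using tendsto_mult_left[OF tendsto_L1_dominated[OF lim.hyps(1) lim.hyps(4) lim.hyps(2) lim.hyps(3)], of K] by simp
    have du: "\<bar>(\<integral>x. s i x * u n x \<partial>M) - (\<integral>x. g x * u n x \<partial>M)\<bar> \<le> d i" for i n
      unfolding d_def by (rule integral_diff_mult_bounded[OF lim.hyps(1) lim.hyps(4) u])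
    have df: "\<bar>(\<integral>x. s i x * f x \<partial>M) - (\<integral>x. g x * f x \<partial>M)\<bar> \<le> d i" for i
      unfolding d_def by (rule integral_diff_mult_bounded[OF lim.hyps(1) lim.hyps(4) f])
    show ?case
    proof (rule metric_LIMSEQ_I)
      fix e :: real assume "0 < e"
      then obtain i where i: "d i < e / 3"
        using order_tendstoD(2)[OF z, of "e / 3"] by (auto simp: eventually_sequentially)
      obtain n0 where n0: "\<And>n. n \<ge> n0 \<Longrightarrow> dist (\<integral>x. s i x * u n x \<partial>M) (\<integral>x. s i x * f x \<partial>M) < e / 3"
        using metric_LIMSEQ_D[OF lim.IH[of i], of "e / 3"] \<open>0 < e\<close> by auto
      have "dist (\<integral>x. g x * u n x \<partial>M) (\<integral>x. g x * f x \<partial>M) < e" if "n \<ge> n0" for n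
        using n0[OF that] du[of i n] df[of i] i unfolding dist_real_def by linarith
      then show "\<exists>n0. \<forall>n\<ge>n0. dist (\<integral>x. g x * u n x \<partial>M) (\<integral>x. g x * f x \<partial>M) < e" by blast
    qed
  qed
  then show "(\<lambda>n. \<Lambda> (u n)) \<longlonglongrightarrow> \<Lambda> f"
    using int[OF u] int[OF f] by (simp add: \<Lambda> mult.commute)
qed

text \<open>The set function of \<open>f\<close> has some density between \<open>0\<close> and \<open>K\<close>, and densities are unique.\<close>

lemma (in finite_measure) dominated_additive_imp_AE_bounds:
  assumes f: "integrable M f" and K: "0 \<le> K"
    and dom: "dominated_additive M K (\<lambda>A. \<integral>x. f x * indicator A x \<partial>M)"
  shows "AE x in M. 0 \<le> f x \<and> f x \<le> K"
proof -
  obtain g where g: "g \<in> borel_measurable M" "\<And>x. 0 \<le> g x" "\<And>x. g x \<le> K"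
    and eq: "\<And>A. A \<in> sets M \<Longrightarrow> (\<integral>x. f x * indicator A x \<partial>M) = (\<integral>x. g x * indicator A x \<partial>M)"
    using dominated_additive_density[OF dom K] by metis
  have "integrable M g" using g by (intro integrable_const_bound[of _ K]) auto
  then have "AE x in M. f x = g x"
    using f eq by (intro density_unique_real) (auto simp: set_lebesgue_integral_def mult.commute)
  then show ?thesis by eventually_elim (use g in auto)
qed

lemma (in finite_measure) weakly_precompact_L1I:
  assumes G: "countable_pi_generator M G" and K: "0 \<le> K"
    and int: "\<And>f. f \<in> F \<Longrightarrow> integrable M f"
    and dom: "\<And>f. f \<in> F \<Longrightarrow> dominated_additive M K (\<lambda>A. \<integral>x. f x * indicator A x \<partial>M)"
  shows "weakly_precompact_L1 M F"
  unfolding weakly_precompact_L1_def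
proof (intro conjI ballI allI impI)
  fix u :: "nat \<Rightarrow> 'a \<Rightarrow> real" assume u: "\<forall>n. u n \<in> F"
  define a where "a n A = (\<integral>x. u n x * indicator A x \<partial>M)" for n A
  have dom_a: "dominated_additive M K (a n)" for n
    unfolding a_def using dom u by blast
  show "\<exists>r f. strict_mono r \<and> integrable M f \<and> weakly_converges_L1 M (u \<circ> r) f"
  proof (rule dominated_additive_compact[OF G dom_a K])
    fix r f assume r: "strict_mono r" and f: "f \<in> borel_measurable M" "\<And>x. 0 \<le> f x" "\<And>x. f x \<le> K"
      and lim: "\<And>A. A \<in> sets M \<Longrightarrow> (\<lambda>n. a (r n) A) \<longlonglongrightarrow> (\<integral>x. f x * indicator A x \<partial>M)"
  have "weakly_converges_L1 M (u \<circ> r) f"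
  proof (rule weakly_converges_L1I[where K = K])
    fix n
    have "AE x in M. 0 \<le> u (r n) x \<and> u (r n) x \<le> K"
      using dominated_additive_imp_AE_bounds[OF int K dom] u by blast
    then show "AE x in M. \<bar>(u \<circ> r) n x\<bar> \<le> K" by eventually_elim auto
    show "(u \<circ> r) n \<in> borel_measurable M" using int u by (metis borel_measurable_integrable comp_apply)
  qed (use f lim in \<open>auto simp: a_def\<close>)
  moreover have "integrable M f" using f by (intro integrable_const_bound[of _ K]) auto
  ultimately show "\<exists>r f. strict_mono r \<and> integrable M f \<and> weakly_converges_L1 M (u \<circ> r) f"
    using r by blast
  qed
qed (use int in auto)

section \<open>Transfer operators\<close>

lemma nonsingular_AE:
  assumes S: "nonsingular M S" and Q: "AE x in M. Q x"
  shows "AE x in M. Q (S x)"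
proof -
  have "AE x in distr M M S. Q x"
    by (rule absolutely_continuous_AE[OF _ _ Q]) (use S in \<open>auto simp: nonsingular_def\<close>)
  then show ?thesis
    using S by (intro AE_distrD[of S M M]) (auto simp: nonsingular_def)
qed

lemma nonsingular_vimage_null:
  assumes S: "nonsingular M S" and A: "A \<in> null_sets M"
  shows "S -` A \<inter> space M \<in> null_sets M"
  using assms by (auto simp: nonsingular_def absolutely_continuous_def null_sets_distr_iff)

lemma Linf_compose:
  assumes S: "nonsingular M S" and g: "g \<in> Linf M"
  shows "(\<lambda>x. g (S x)) \<in> Linf M"
proof -
  obtain K where K: "AE x in M. \<bar>g x\<bar> \<le> K" using g by (auto simp: Linf_def)
  have [measurable]: "g \<in> borel_measurable M" "S \<in> M \<rightarrow>\<^sub>M M"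
    using g S by (auto simp: Linf_def nonsingular_def)
  show ?thesis using nonsingular_AE[OF S K] by (auto simp: Linf_def)
qed

lemma indicator_Linf: "A \<in> sets M \<Longrightarrow> indicator A \<in> Linf M"
  by (auto simp: Linf_def indicator_def intro!: exI[of _ 1])

lemma (in finite_measure) integrable_mult_Linf:
  "integrable M f \<Longrightarrow> g \<in> Linf M \<Longrightarrow> integrable M (\<lambda>x. f x * g x)"
  using integrable_mult_bounded by (auto simp: Linf_def)

text \<open>The image of \<open>f m\<close> under the non-singular map \<open>S\<close> is absolutely continuous, and its density
  is the required function.\<close>

lemma (in finite_measure) transfer_operator_exists_nonneg:
  fixes f :: "'a \<Rightarrow> real"
  assumes S: "nonsingular M S" and f: "integrable M f" and f0: "\<And>x. 0 \<le> f x"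
  shows "\<exists>f'. integrable M f' \<and> (\<forall>g\<in>Linf M. (\<integral>x. f' x * g x \<partial>M) = (\<integral>x. f x * g (S x) \<partial>M))"
proof -
  have [measurable]: "S \<in> M \<rightarrow>\<^sub>M M" "f \<in> borel_measurable M"
    using S f by (auto simp: nonsingular_def)
  let ?\<mu> = "density M (\<lambda>x. ennreal (f x))"
  define N where "N = distr ?\<mu> M S"
  have sets_N[measurable_cong]: "sets N = sets M" by (simp add: N_def)
  have "emeasure ?\<mu> (space M) = (\<integral>\<^sup>+x. ennreal (f x) \<partial>M)"
    by (simp add: emeasure_density cong: nn_integral_cong)
  also have "\<dots> \<noteq> \<infinity>" using f f0 by (simp add: nn_integral_eq_integral)
  finally interpret \<mu>: finite_measure ?\<mu> by (intro finite_measureI) simp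
  interpret N: finite_measure N unfolding N_def by (rule \<mu>.finite_measure_distr) simp
  have ac: "absolutely_continuous M N"
    unfolding absolutely_continuous_def
  proof
    fix A assume A: "A \<in> null_sets M"
    have "S -` A \<inter> space M \<in> null_sets ?\<mu>"
      using nonsingular_vimage_null[OF S A] absolutely_continuousI_density[of "\<lambda>x. ennreal (f x)" M]
      by (auto simp: absolutely_continuous_def)
    then show "A \<in> null_sets N" using A by (simp add: N_def null_sets_distr_iff null_setsD2)
  qed
  obtain D where D[measurable]: "D \<in> borel_measurable M"
    and RN: "AE x in M. RN_deriv M N x = ennreal (D x)" and D0: "\<And>x. 0 \<le> D x"
    using real_RN_deriv[OF N.finite_measure_axioms ac sets_N] by metis
  have "N = density M (RN_deriv M N)" by (rule density_RN_deriv[OF ac sets_N, symmetric])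
  also have "\<dots> = density M (\<lambda>x. ennreal (D x))" using RN by (intro density_cong) auto
  finally have N: "N = density M (\<lambda>x. ennreal (D x))" .
  have "integrable M D"
  proof (rule integrableI_bounded)
    have "(\<integral>\<^sup>+x. ennreal (norm (D x)) \<partial>M) = emeasure N (space M)"
      unfolding N using D0 by (simp add: emeasure_density cong: nn_integral_cong)
    then show "(\<integral>\<^sup>+x. ennreal (norm (D x)) \<partial>M) < \<infinity>" by (simp add: less_top[symmetric])
  qed simp
  moreover have "(\<integral>x. D x * g x \<partial>M) = (\<integral>x. f x * g (S x) \<partial>M)" if "g \<in> Linf M" for g
  proof -
    have [measurable]: "g \<in> borel_measurable M" using that by (simp add: Linf_def)
    have "(\<integral>x. D x * g x \<partial>M) = (\<integral>x. g x \<partial>N)"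
      unfolding N using D0 by (subst integral_real_density) auto
    also have "\<dots> = (\<integral>x. g (S x) \<partial>?\<mu>)" unfolding N_def by (subst integral_distr) auto
    also have "\<dots> = (\<integral>x. f x * g (S x) \<partial>M)" using f0 by (subst integral_real_density) auto
    finally show ?thesis .
  qed
  ultimately show ?thesis by blast
qed

lemma (in finite_measure) perron_frobenius_spec:
  assumes S: "nonsingular M S" and f: "integrable M f"
  shows "integrable M (perron_frobenius M S f)"
    and "g \<in> Linf M \<Longrightarrow> (\<integral>x. perron_frobenius M S f x * g x \<partial>M) = (\<integral>x. f x * g (S x) \<partial>M)"
proof -
  let ?p = "\<lambda>x. max 0 (f x)" and ?n = "\<lambda>x. max 0 (- f x)"
  have i: "integrable M ?p" "integrable M ?n" using f by auto
  obtain p where p: "integrable M p"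
      "\<And>g. g \<in> Linf M \<Longrightarrow> (\<integral>x. p x * g x \<partial>M) = (\<integral>x. ?p x * g (S x) \<partial>M)"
    using transfer_operator_exists_nonneg[OF S i(1)] by auto
  obtain n where n: "integrable M n"
      "\<And>g. g \<in> Linf M \<Longrightarrow> (\<integral>x. n x * g x \<partial>M) = (\<integral>x. ?n x * g (S x) \<partial>M)"
    using transfer_operator_exists_nonneg[OF S i(2)] by auto
  have "\<exists>f'. integrable M f' \<and> (\<forall>g\<in>Linf M. (\<integral>x. f' x * g x \<partial>M) = (\<integral>x. f x * g (S x) \<partial>M))"
  proof (intro exI[of _ "\<lambda>x. p x - n x"] conjI ballI)
    fix g assume g: "g \<in> Linf M"
    note gS = Linf_compose[OF S g]
    have "(\<integral>x. (p x - n x) * g x \<partial>M) = (\<integral>x. ?p x * g (S x) \<partial>M) - (\<integral>x. ?n x * g (S x) \<partial>M)"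
      using integrable_mult_Linf[OF p(1) g] integrable_mult_Linf[OF n(1) g] p(2)[OF g] n(2)[OF g]
      by (simp add: left_diff_distrib)
    also have "\<dots> = (\<integral>x. ?p x * g (S x) - ?n x * g (S x) \<partial>M)"
      using integrable_mult_Linf[OF i(1) gS] integrable_mult_Linf[OF i(2) gS] by simp
    also have "\<dots> = (\<integral>x. f x * g (S x) \<partial>M)"
      by (intro Bochner_Integration.integral_cong) (auto simp: max_def)
    finally show "(\<integral>x. (p x - n x) * g x \<partial>M) = (\<integral>x. f x * g (S x) \<partial>M)" .
  qed (use p n in simp)
  from someI_ex[OF this] show "integrable M (perron_frobenius M S f)"
    and "g \<in> Linf M \<Longrightarrow> (\<integral>x. perron_frobenius M S f x * g x \<partial>M) = (\<integral>x. f x * g (S x) \<partial>M)"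
    by (auto simp: perron_frobenius_def)
qed

text \<open>Testing on a countable generator characterises the transfer operator. This form allows the
  identification of transfer operators on almost every fibre of a product.\<close>

lemma (in finite_measure) perron_frobenius_unique:
  assumes G: "countable_pi_generator M G" and S: "nonsingular M S" and f: "integrable M f"
    and F: "integrable M F"
      "\<And>A. A \<in> G \<Longrightarrow> (\<integral>x. F x * indicator A x \<partial>M) = (\<integral>x. f x * indicator A (S x) \<partial>M)"
  shows "AE x in M. F x = perron_frobenius M S f x"
proof (rule AE_eq_if_integrals_agree_on_generator[OF G F(1) perron_frobenius_spec(1)[OF S f]])
  fix A assume A: "A \<in> G"
  show "(\<integral>x. F x * indicator A x \<partial>M) = (\<integral>x. perron_frobenius M S f x * indicator A x \<partial>M)"
    unfolding F(2)[OF A]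
    using perron_frobenius_spec(2)[OF S f indicator_Linf[OF countable_pi_generator_in_sets[OF G A]]]
    by simp
qed


section \<open>Distortion\<close>

lemma essinf_lessD:
  assumes "y < essinf M f"
  shows "AE x in M. y < f x"
  using assms unfolding essinf_def by (auto split: if_splits dest: less_LiminfD)

lemma the_inv_into_image_eq:
  assumes "inj_on S Z" "A \<subseteq> S ` Z"
  shows "the_inv_into Z S ` A = Z \<inter> S -` A"
proof
  show "the_inv_into Z S ` A \<subseteq> Z \<inter> S -` A"
    using assms by (auto simp: the_inv_into_f_f)
  show "Z \<inter> S -` A \<subseteq> the_inv_into Z S ` A"
    using assms(1) by (auto simp: the_inv_into_f_f intro!: image_eqI[where x = "S _"])
qed

text \<open>On the image \<open>Y = S(Z)\<close> the density of \<open>m \<circ> V\<close>, where \<open>V\<close> inverts \<open>S\<close> on \<open>Z\<close>, has mean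
  \<open>m(Z) / m(Y)\<close>. Its essential infimum is at most this mean, so by the distortion hypothesis its
  essential supremum is at most \<open>C\<close> times the mean, and integrating over \<open>A \<inter> Y\<close> gives the
  claim. The image measure \<open>N\<close> below is \<open>m \<circ> V\<close>, written without \<open>V\<close>.\<close>

lemma (in finite_measure) distortion_estimate:
  assumes S: "nonsingular M S" and Z: "Z \<in> sets M" "inj_on S Z" and Y: "S ` Z \<in> sets M"
    and distortion: "esssup (restrict_space M (S ` Z)) (image_density M (S ` Z) (the_inv_into Z S))
      \<le> ennreal C * essinf (restrict_space M (S ` Z)) (image_density M (S ` Z) (the_inv_into Z S))"
    and A: "A \<in> sets M"
  shows "emeasure M (Z \<inter> S -` A) * emeasure M (S ` Z) \<le> ennreal C * emeasure M Z * emeasure M A"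
proof -
  define R where "R = restrict_space M (S ` Z)"
  define N where "N = distr (restrict_space M Z) R S"
  have S_meas[measurable]: "S \<in> M \<rightarrow>\<^sub>M M" using S by (simp add: nonsingular_def)
  have ZM: "Z \<subseteq> space M" using Z(1) sets.sets_into_space by auto
  have YM: "S ` Z \<subseteq> space M" using Y sets.sets_into_space by auto
  have [measurable]: "S \<in> restrict_space M Z \<rightarrow>\<^sub>M R"
    unfolding R_def by (rule measurable_restrict_space3) auto
  have sets_R: "sets R = {B \<in> sets M. B \<subseteq> S ` Z}" and space_R: "space R = S ` Z"
    using Y YM unfolding R_def by (auto simp: sets_restrict_space_iff space_restrict_space)
  have R_emeasure: "emeasure R B = emeasure M B" if "B \<in> sets R" for B
    using that YM Y sets_R unfolding R_def by (subst emeasure_restrict_space) auto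
  have sets_N: "sets N = sets R" and space_N: "space N = S ` Z"
    by (auto simp: N_def space_R)
  have N_emeasure: "emeasure N B = emeasure M (Z \<inter> S -` B)" if "B \<in> sets R" for B
  proof -
    have "emeasure N B = emeasure (restrict_space M Z) (S -` B \<inter> space (restrict_space M Z))"
      using that unfolding N_def by (intro emeasure_distr) auto
    also have "S -` B \<inter> space (restrict_space M Z) = Z \<inter> S -` B"
      using ZM by (auto simp: space_restrict_space)
    also have "emeasure (restrict_space M Z) \<dots> = emeasure M (Z \<inter> S -` B)"
      using Z(1) ZM by (intro emeasure_restrict_space) auto
    finally show ?thesis .
  qed
  \<comment> \<open>Since \<open>V(A) = Z \<inter> S\<^sup>-\<^sup>1 A\<close>, the set function \<open>m \<circ> V\<close> is the measure \<open>N\<close>.\<close>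
  have "measure_of (S ` Z) (sets R) (\<lambda>A. emeasure M (the_inv_into Z S ` A))
      = measure_of (S ` Z) (sets R) (emeasure N)"
  proof (rule measure_of_eq)
    show "sets R \<subseteq> Pow (S ` Z)" using sets_R by auto
    fix B assume "B \<in> sigma_sets (S ` Z) (sets R)"
    then have "B \<in> sets R" using sets.sigma_sets_eq[of R] by (simp add: space_R)
    then show "emeasure M (the_inv_into Z S ` B) = emeasure N B"
      using sets_R Z(2) by (simp add: N_emeasure the_inv_into_image_eq)
  qed
  also have "\<dots> = N" using measure_of_of_measure[of N] by (simp add: sets_N space_N)
  finally have D: "image_density M (S ` Z) (the_inv_into Z S) = RN_deriv R N"
    by (simp add: image_density_def R_def)
  interpret R: finite_measure R
    using YM Y unfolding R_def by (intro finite_measure_restrict_space finite_measure_axioms) auto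
  have "absolutely_continuous R N"
    unfolding absolutely_continuous_def
  proof
    fix B assume "B \<in> null_sets R"
    then have B: "B \<in> sets R" "B \<in> null_sets M" using sets_R R_emeasure by (auto simp: null_sets_def)
    have "Z \<inter> S -` B = Z \<inter> (S -` B \<inter> space M)" using ZM by auto
    moreover have "Z \<inter> (S -` B \<inter> space M) \<in> null_sets M"
      using null_set_Int1[OF nonsingular_vimage_null[OF S B(2)] Z(1)] .
    ultimately show "B \<in> null_sets N"
      using B N_emeasure sets_N by (auto simp: null_sets_def)
  qed
  then have dens: "density R (RN_deriv R N) = N"
    using sets_N by (intro R.density_RN_deriv)
  have N_int: "emeasure N B = (\<integral>\<^sup>+x. RN_deriv R N x * indicator B x \<partial>R)" if "B \<in> sets R" for B
    using that by (subst dens[symmetric]) (simp add: emeasure_density)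
  define s where "s = esssup R (RN_deriv R N)"
  define l where "l = essinf R (RN_deriv R N)"
  have sl: "s \<le> ennreal C * l"
    using distortion unfolding s_def l_def D R_def[symmetric] .
  have AY: "A \<inter> S ` Z \<in> sets R" using A Y sets_R by auto
  have "emeasure M (Z \<inter> S -` A) = emeasure N (A \<inter> S ` Z)"
    by (subst N_emeasure[OF AY]) (auto intro!: arg_cong[where f = "emeasure M"])
  also have "\<dots> \<le> (\<integral>\<^sup>+x. s * indicator (A \<inter> S ` Z) x \<partial>R)"
    unfolding N_int[OF AY] s_def using esssup_AE[of "RN_deriv R N" R]
    by (intro nn_integral_mono_AE) (auto elim!: eventually_mono intro!: mult_right_mono)
  also have "\<dots> = s * emeasure M (A \<inter> S ` Z)"
    using AY by (simp add: nn_integral_cmult_indicator R_emeasure)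
  also have "\<dots> \<le> (ennreal C * l) * emeasure M A"
    using sl A by (intro mult_mono emeasure_mono) auto
  finally have upper: "emeasure M (Z \<inter> S -` A) \<le> ennreal C * l * emeasure M A" .
  have YR: "S ` Z \<in> sets R" using sets.top[of R] by (simp add: space_R)
  have lower: "l * emeasure M (S ` Z) \<le> emeasure M Z"
  proof (cases "emeasure M (S ` Z) = 0")
    case True then show ?thesis by simp
  next
    case False
    have fin: "emeasure M (S ` Z) < top" by (simp add: less_top[symmetric])
    \<comment> \<open>The essential infimum is approached from below, since only values strictly below it are
      known to be exceeded almost everywhere.\<close>
    have "l \<le> emeasure M Z / emeasure M (S ` Z)"
    proof (rule dense_le)
      fix y assume "y < l"
      then have "AE x in R. y < RN_deriv R N x" unfolding l_def by (rule essinf_lessD)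
      then have "(\<integral>\<^sup>+x. y * indicator (S ` Z) x \<partial>R) \<le> emeasure N (S ` Z)"
        unfolding N_int[OF YR]
        by (intro nn_integral_mono_AE) (auto elim!: eventually_mono intro!: mult_right_mono)
      also have "emeasure N (S ` Z) = emeasure M Z"
        by (subst N_emeasure[OF YR]) (auto intro!: arg_cong[where f = "emeasure M"])
      finally have "y * emeasure M (S ` Z) \<le> emeasure M Z"
        using YR by (simp add: nn_integral_cmult_indicator R_emeasure)
      then have "y * emeasure M (S ` Z) / emeasure M (S ` Z) \<le> emeasure M Z / emeasure M (S ` Z)"
        by (rule divide_right_mono_ennreal)
      then show "y \<le> emeasure M Z / emeasure M (S ` Z)"
        using False fin by (simp add: ennreal_mult_divide_eq)
    qed
    then have "l * emeasure M (S ` Z) \<le> emeasure M Z / emeasure M (S ` Z) * emeasure M (S ` Z)"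
      by (intro mult_right_mono) auto
    also have "\<dots> = emeasure M Z"
      using False fin by (simp add: ennreal_divide_times)
    finally show ?thesis .
  qed
  have "emeasure M (Z \<inter> S -` A) * emeasure M (S ` Z)
      \<le> ennreal C * l * emeasure M A * emeasure M (S ` Z)"
    by (rule mult_right_mono[OF upper]) simp
  also have "\<dots> = ennreal C * (l * emeasure M (S ` Z)) * emeasure M A" by (simp add: mult_ac)
  also have "\<dots> \<le> ennreal C * emeasure M Z * emeasure M A"
    by (intro mult_right_mono mult_left_mono lower) auto
  finally show ?thesis .
qed

text \<open>An estimate relative to each piece of a countable partition sums to a global one. The sum over
  the pieces is an integral over the counting measure, so that Tonelli's theorem exchanges it with
  the integral over the space; almost everywhere it counts exactly one piece.\<close>

lemma emeasure_le_of_countable_AE_partition: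
  assumes W: "countable W" and Z: "\<And>w. w \<in> W \<Longrightarrow> Z w \<in> sets M"
    and part: "AE x in M. \<exists>!w. w \<in> W \<and> x \<in> Z w"
    and E: "E \<in> sets M" and le: "\<And>w. w \<in> W \<Longrightarrow> emeasure M (Z w \<inter> E) \<le> k * emeasure M (Z w)"
  shows "emeasure M E \<le> k * emeasure M (space M)"
proof -
  have one: "AE x in M. (\<integral>\<^sup>+w. indicator (Z w) x \<partial>count_space W) = (1 :: ennreal)"
    using part
  proof eventually_elim
    case (elim x)
    then obtain v where v: "v \<in> W" "\<And>w. w \<in> W \<Longrightarrow> x \<in> Z w \<longleftrightarrow> w = v" by metis
    have "(\<integral>\<^sup>+w. indicator (Z w) x \<partial>count_space W) = (\<integral>\<^sup>+w. indicator {v} w \<partial>count_space W)"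
      by (intro nn_integral_cong) (simp add: v(2) indicator_def)
    then show ?case using v(1) by simp
  qed
  have "emeasure M E = (\<integral>\<^sup>+x. indicator E x \<partial>M)" using E by simp
  also have "\<dots> = (\<integral>\<^sup>+x. (\<integral>\<^sup>+w. indicator (Z w \<inter> E) x \<partial>count_space W) \<partial>M)"
  proof (rule nn_integral_cong_AE)
    show "AE x in M. indicator E x = (\<integral>\<^sup>+w. indicator (Z w \<inter> E) x \<partial>count_space W)"
      using one by eventually_elim (auto simp: indicator_inter_arith nn_integral_multc)
  qed
  also have "\<dots> = (\<integral>\<^sup>+w. emeasure M (Z w \<inter> E) \<partial>count_space W)"
    using Z E by (subst nn_integral_count_space_nn_integral[OF W]) (auto intro!: nn_integral_cong)
  also have "\<dots> \<le> (\<integral>\<^sup>+w. k * emeasure M (Z w) \<partial>count_space W)"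
    using le by (intro nn_integral_mono) auto
  also have "\<dots> = k * (\<integral>\<^sup>+w. emeasure M (Z w) \<partial>count_space W)"
    by (simp add: nn_integral_cmult)
  also have "(\<integral>\<^sup>+w. emeasure M (Z w) \<partial>count_space W) = (\<integral>\<^sup>+x. (\<integral>\<^sup>+w. indicator (Z w) x \<partial>count_space W) \<partial>M)"
    using Z by (subst nn_integral_count_space_nn_integral[OF W]) (auto intro!: nn_integral_cong)
  also have "\<dots> = (\<integral>\<^sup>+x. 1 \<partial>M)" using one by (rule nn_integral_cong_AE)
  finally show ?thesis by simp
qed

section \<open>Random systems\<close>

lemma nonsingularI:
  assumes "S \<in> M \<rightarrow>\<^sub>M M" "\<And>A. A \<in> null_sets M \<Longrightarrow> S -` A \<inter> space M \<in> null_sets M"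
  shows "nonsingular M S"
  unfolding nonsingular_def absolutely_continuous_def
proof (intro conjI subsetI)
  fix A assume "A \<in> null_sets M"
  then show "A \<in> null_sets (distr M M S)"
    using assms(2)[of A] by (simp add: null_sets_distr_iff[OF assms(1)] null_setsD2)
qed (rule assms(1))

lemma nonsingular_id: "nonsingular M id"
proof (rule nonsingularI)
  fix A assume "A \<in> null_sets M"
  then show "id -` A \<inter> space M \<in> null_sets M" by auto
qed auto

lemma nonsingular_comp:
  assumes S: "nonsingular M S" and R: "nonsingular M R"
  shows "nonsingular M (R \<circ> S)"
proof (rule nonsingularI)
  have meas: "S \<in> M \<rightarrow>\<^sub>M M" "R \<in> M \<rightarrow>\<^sub>M M" using S R by (auto simp: nonsingular_def)
  then show "R \<circ> S \<in> M \<rightarrow>\<^sub>M M" by (rule measurable_comp)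
  fix A assume "A \<in> null_sets M"
  then have "S -` (R -` A \<inter> space M) \<inter> space M \<in> null_sets M"
    by (intro nonsingular_vimage_null S R)
  moreover have "S -` (R -` A \<inter> space M) \<inter> space M = (R \<circ> S) -` A \<inter> space M"
    using measurable_space[OF meas(1)] by auto
  ultimately show "(R \<circ> S) -` A \<inter> space M \<in> null_sets M" by simp
qed

context random_system
begin

abbreviation "\<tau> \<equiv> inv_on \<Omega> \<sigma>"

sublocale \<Omega>: prob_space \<Omega>
  using standard_base by (simp add: standard_prob_space_def)

sublocale M: prob_space M
  using standard_fibre by (simp add: standard_prob_space_def)

lemma \<sigma>_measurable[measurable]: "\<sigma> \<in> \<Omega> \<rightarrow>\<^sub>M \<Omega>"
  and \<tau>_measurable[measurable]: "\<tau> \<in> \<Omega> \<rightarrow>\<^sub>M \<Omega>"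
  and distr_\<sigma>: "distr \<Omega> \<Omega> \<sigma> = \<Omega>"
  using invertible_base preserving_base
  by (auto simp: invertible_on_def measure_preserving_on_def)

lemma \<tau>_\<sigma>: "\<omega> \<in> space \<Omega> \<Longrightarrow> \<tau> (\<sigma> \<omega>) = \<omega>"
  using invertible_base the_inv_into_f_f[of \<sigma> "space \<Omega>" \<omega>]
  by (auto simp: invertible_on_def bij_betw_def)

lemma \<sigma>_pow_measurable[measurable]: "\<sigma> ^^ n \<in> \<Omega> \<rightarrow>\<^sub>M \<Omega>"
  and \<tau>_pow_measurable[measurable]: "\<tau> ^^ n \<in> \<Omega> \<rightarrow>\<^sub>M \<Omega>"
  by (induction n) (auto intro: measurable_comp[OF _ \<sigma>_measurable] measurable_comp[OF _ \<tau>_measurable])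

lemma \<sigma>_pow_in_space: "\<omega> \<in> space \<Omega> \<Longrightarrow> (\<sigma> ^^ n) \<omega> \<in> space \<Omega>"
  and \<tau>_pow_in_space: "\<omega> \<in> space \<Omega> \<Longrightarrow> (\<tau> ^^ n) \<omega> \<in> space \<Omega>"
  using measurable_space[OF \<sigma>_pow_measurable] measurable_space[OF \<tau>_pow_measurable] by auto

lemma \<tau>_pow_\<sigma>_pow: "\<omega> \<in> space \<Omega> \<Longrightarrow> (\<tau> ^^ n) ((\<sigma> ^^ n) \<omega>) = \<omega>"
proof (induction n)
  case (Suc n)
  have "(\<tau> ^^ Suc n) ((\<sigma> ^^ Suc n) \<omega>) = (\<tau> ^^ n) (\<tau> (\<sigma> ((\<sigma> ^^ n) \<omega>)))"
    by (simp add: funpow_swap1)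
  then show ?case using Suc by (simp add: \<tau>_\<sigma> \<sigma>_pow_in_space)
qed simp

lemma distr_\<sigma>_pow: "distr \<Omega> \<Omega> (\<sigma> ^^ n) = \<Omega>"
proof (induction n)
  case 0 then show ?case by (simp add: id_def distr_id)
next
  case (Suc n)
  have "distr \<Omega> \<Omega> (\<sigma> ^^ Suc n) = distr (distr \<Omega> \<Omega> (\<sigma> ^^ n)) \<Omega> \<sigma>"
    by (subst distr_distr) auto
  then show ?case by (simp only: Suc.IH distr_\<sigma>)
qed

lemma nonsingular_cocycle:
  assumes "\<omega> \<in> space \<Omega>"
  shows "nonsingular M (cocycle \<sigma> T n \<omega>)"
  using assms
  by (induction n) (auto simp: nonsingular_id \<sigma>_pow_in_space simp del: comp_apply
      intro!: nonsingular_comp nonsingular_fibre)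

lemma nonsingular_pullback:
  "\<omega> \<in> space \<Omega> \<Longrightarrow> nonsingular M (pullback_cocycle \<Omega> \<sigma> T n \<omega>)"
  unfolding pullback_cocycle_def by (intro nonsingular_cocycle \<tau>_pow_in_space)

end

context random_fibered_system
begin

lemma cylinder_iff:
  assumes "w \<noteq> []"
  shows "x \<in> cylinder \<Omega> \<sigma> M T X \<omega> w \<longleftrightarrow>
    x \<in> space M \<and> (\<forall>k<length w. cocycle \<sigma> T k ((\<tau> ^^ length w) \<omega>) x \<in> X (w ! k))"
  using assms by (fastforce simp: cylinder_def simp del: INT_simps)

lemma X_sets: "i \<in> I \<Longrightarrow> X i \<in> sets M"
  using partition by (auto simp: partition_mod_null_def)

lemma AE_unique_index: "AE x in M. \<exists>!i. i \<in> I \<and> x \<in> X i"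
proof -
  have "AE x in M. x \<notin> space M - (\<Union>i\<in>I. X i)"
    using partition by (intro AE_not_in) (auto simp: partition_mod_null_def)
  moreover have "AE x in M. \<forall>i\<in>I. \<forall>j\<in>I. i \<noteq> j \<longrightarrow> x \<notin> X i \<inter> X j"
    using partition
    by (auto simp: AE_ball_countable index_countable partition_mod_null_def simp del: Int_iff
        intro: AE_not_in)
  ultimately show ?thesis
    using AE_space by eventually_elim blast
qed

text \<open>Cylinders of a given length partition the space up to null sets: the fibre maps are
  non-singular, so almost every orbit meets, at each time, exactly one of the
  sets \<open>X i\<close>.\<close>

lemma AE_unique_word:
  assumes \<omega>: "\<omega> \<in> space \<Omega>" and n: "0 < n"
  shows "AE x in M. \<exists>!w. w \<in> {w \<in> words I. length w = n} \<and> x \<in> cylinder \<Omega> \<sigma> M T X \<omega> w"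
proof -
  let ?S = "\<lambda>k. cocycle \<sigma> T k ((\<tau> ^^ n) \<omega>)"
  have "AE x in M. \<forall>k\<in>{..<n}. \<exists>!i. i \<in> I \<and> ?S k x \<in> X i"
    by (intro AE_ball_countable[THEN iffD2] ballI)
      (auto intro!: nonsingular_AE[OF nonsingular_cocycle AE_unique_index] \<tau>_pow_in_space \<omega>)
  then show ?thesis
    using AE_space
  proof eventually_elim
    case (elim x)
    then obtain i where i: "\<And>k. k < n \<Longrightarrow> i k \<in> I" "\<And>k. k < n \<Longrightarrow> ?S k x \<in> X (i k)"
      "\<And>k j. k < n \<Longrightarrow> j \<in> I \<Longrightarrow> ?S k x \<in> X j \<Longrightarrow> j = i k"
      by (simp add: Ball_def) metis
    show ?case
    proof (rule ex1I[of _ "map i [0..<n]"])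
      show "map i [0..<n] \<in> {w \<in> words I. length w = n} \<and> x \<in> cylinder \<Omega> \<sigma> M T X \<omega> (map i [0..<n])"
        using n i(1,2) elim(2) by (subst cylinder_iff) auto
      fix w assume w: "w \<in> {w \<in> words I. length w = n} \<and> x \<in> cylinder \<Omega> \<sigma> M T X \<omega> w"
      show "w = map i [0..<n]"
      proof (rule nth_equalityI)
        fix k assume k: "k < length w"
        have "w ! k \<in> I" using w nth_mem[OF k] by auto
        moreover have "?S k x \<in> X (w ! k)" using w k by (auto simp: cylinder_iff)
        ultimately show "w ! k = map i [0..<n] ! k" using w k i(3)[of k "w ! k"] by simp
      qed (use w in simp)
    qed
  qed
qed

lemma cylinder_sets:
  assumes \<omega>: "\<omega> \<in> space \<Omega>" and w: "w \<in> words I"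
  shows "cylinder \<Omega> \<sigma> M T X \<omega> w \<in> sets M"
proof -
  have "cocycle \<sigma> T k ((\<tau> ^^ length w) \<omega>) -` X (w ! k) \<inter> space M \<in> sets M" if "k < length w" for k
  proof (rule measurable_sets)
    show "cocycle \<sigma> T k ((\<tau> ^^ length w) \<omega>) \<in> M \<rightarrow>\<^sub>M M"
      using nonsingular_cocycle[OF \<tau>_pow_in_space[OF \<omega>]] by (auto simp: nonsingular_def)
    show "X (w ! k) \<in> sets M"
      using w nth_mem[OF that] by (intro X_sets) auto
  qed
  then show ?thesis
    unfolding cylinder_def using w by (intro sets.finite_INT) auto
qed

text \<open>Two points with the same itinerary and the same endpoint are identified backwards, one
  injective branch at a time.\<close>

lemma inj_on_cylinder:
  assumes \<omega>: "\<omega> \<in> space \<Omega>" and w: "w \<in> words I"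
  shows "inj_on (pullback_cocycle \<Omega> \<sigma> T (length w) \<omega>) (cylinder \<Omega> \<sigma> M T X \<omega> w)"
proof -
  let ?\<eta> = "(\<tau> ^^ length w) \<omega>"
  let ?S = "\<lambda>k. cocycle \<sigma> T k ?\<eta>"
  have eq: "x = y" if "n \<le> length w" "?S n x = ?S n y"
    "\<And>k. k < n \<Longrightarrow> ?S k x \<in> X (w ! k) \<and> ?S k y \<in> X (w ! k)" for n x y
    using that
  proof (induction n)
    case (Suc n)
    have "w ! n \<in> I" using w Suc.prems(1) nth_mem[of n w] by auto
    then have "inj_on (T ((\<sigma> ^^ n) ?\<eta>)) (X (w ! n))"
      using branch_invertible[of "(\<sigma> ^^ n) ?\<eta>" "w ! n"] \<omega>
      by (simp add: bij_betw_def \<sigma>_pow_in_space \<tau>_pow_in_space)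
    then have "?S n x = ?S n y"
      using Suc.prems(2) Suc.prems(3)[of n] by (auto dest: inj_onD)
    then show ?case using Suc by auto
  qed simp
  show ?thesis
    unfolding pullback_cocycle_def by (rule inj_onI, rule eq[of "length w"]) (use w in \<open>auto simp: cylinder_iff\<close>)
qed

text \<open>The quantitative content of the distortion and large image conditions, with
  \<open>K = max 1 (C / c)\<close>; the maximum takes care of \<open>n = 0\<close>. It says that the densities
  \<open>P\<^sup>(\<^sup>n\<^sup>) 1\<close> arriving at \<open>\<omega>\<close> are bounded by \<open>K\<close>, uniformly in \<open>n\<close> and \<open>\<omega>\<close>.\<close>

lemma pullback_measure_bound:
  obtains K where "1 \<le> K"
    "AE \<omega> in \<Omega>. \<forall>n. \<forall>A\<in>sets M.
       measure M (pullback_cocycle \<Omega> \<sigma> T n \<omega> -` A \<inter> space M) \<le> K * measure M A"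
proof -
  obtain C where C: "1 \<le> C"
    and dist: "AE \<omega> in \<Omega>. \<forall>w\<in>words I. cylinder \<Omega> \<sigma> M T X \<omega> w \<noteq> {} \<longrightarrow>
         (let Y = cylinder_image \<Omega> \<sigma> M T X \<omega> w;
              D = image_density M Y (local_inverse \<Omega> \<sigma> M T X \<omega> w)
          in esssup (restrict_space M Y) D \<le> ennreal C * essinf (restrict_space M Y) D)"
    using bounded_distortion by blast
  obtain c where c: "0 < c"
    and large: "AE \<omega> in \<Omega>. \<forall>w\<in>words I. cylinder \<Omega> \<sigma> M T X \<omega> w \<noteq> {} \<longrightarrow>
         measure M (cylinder_image \<Omega> \<sigma> M T X \<omega> w) > c"
    using large_images by blast
  define K where "K = max 1 (C / c)"
  have K: "0 \<le> K" "1 \<le> K" "C / c \<le> K" by (auto simp: K_def)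
  have "AE \<omega> in \<Omega>. \<forall>n. \<forall>A\<in>sets M.
       measure M (pullback_cocycle \<Omega> \<sigma> T n \<omega> -` A \<inter> space M) \<le> K * measure M A"
    using dist large AE_space
  proof eventually_elim
    case (elim \<omega>)
    show ?case
    proof (intro allI ballI)
      fix n A assume A: "A \<in> sets M"
      let ?S = "pullback_cocycle \<Omega> \<sigma> T n \<omega>" and ?Z = "cylinder \<Omega> \<sigma> M T X \<omega>"
      show "measure M (?S -` A \<inter> space M) \<le> K * measure M A"
      proof (cases "n = 0")
        case True
        then have "?S -` A \<inter> space M = A"
          using sets.sets_into_space[OF A] by (auto simp: pullback_cocycle_def)
        then show ?thesis using K(2) mult_right_mono[of 1 K "measure M A"] by simp
      next
        case False
        let ?W = "{w \<in> words I. length w = n}"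
        have E: "?S -` A \<inter> space M \<in> sets M"
          using nonsingular_pullback[OF elim(3), of n] A
          by (auto simp: nonsingular_def intro: measurable_sets)
        have "emeasure M (?S -` A \<inter> space M) \<le> ennreal K * emeasure M A * emeasure M (space M)"
        proof (rule emeasure_le_of_countable_AE_partition[where W = ?W and Z = ?Z])
          show "countable ?W"
            by (rule countable_subset[OF _ countable_lists[OF index_countable]]) auto
          show "AE x in M. \<exists>!w. w \<in> ?W \<and> x \<in> ?Z w"
            using AE_unique_word[OF elim(3)] False by simp
          show "?Z w \<in> sets M" if "w \<in> ?W" for w
            using that by (intro cylinder_sets elim) auto
          fix w assume w: "w \<in> ?W"
          show "emeasure M (?Z w \<inter> (?S -` A \<inter> space M)) \<le> ennreal K * emeasure M A * emeasure M (?Z w)"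
          proof (cases "?Z w = {}")
            case True then show ?thesis by simp
          next
            case False
            have Z: "?Z w \<in> sets M" using w by (intro cylinder_sets elim) auto
            have Y: "?S ` ?Z w = cylinder_image \<Omega> \<sigma> M T X \<omega> w"
              "the_inv_into (?Z w) ?S = local_inverse \<Omega> \<sigma> M T X \<omega> w"
              using w by (auto simp: cylinder_image_def local_inverse_def)
            have mY: "c < measure M (?S ` ?Z w)"
              using elim(2) w False by (auto simp: Y)
            \<comment> \<open>Non-measurable sets have measure zero by convention, so positive measure gives measurability.\<close>
            then have Y_sets: "?S ` ?Z w \<in> sets M" using c measure_notin_sets[of _ M] by fastforce
            have eq: "?Z w \<inter> (?S -` A \<inter> space M) = ?Z w \<inter> ?S -` A"
              using sets.sets_into_space[OF Z] by auto
            have "emeasure M (?Z w \<inter> ?S -` A) * emeasure M (?S ` ?Z w)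
                \<le> ennreal C * emeasure M (?Z w) * emeasure M A"
            proof (rule M.distortion_estimate[OF nonsingular_pullback[OF elim(3)] Z _ Y_sets _ A])
              show "inj_on ?S (?Z w)" using inj_on_cylinder[OF elim(3), of w] w by auto
              show "esssup (restrict_space M (?S ` ?Z w)) (image_density M (?S ` ?Z w) (the_inv_into (?Z w) ?S))
                 \<le> ennreal C * essinf (restrict_space M (?S ` ?Z w)) (image_density M (?S ` ?Z w) (the_inv_into (?Z w) ?S))"
                unfolding Y using elim(1) w False by (auto simp: Let_def)
            qed
            then have "measure M (?Z w \<inter> ?S -` A) * measure M (?S ` ?Z w) \<le> C * measure M (?Z w) * measure M A"
              using C by (simp add: M.emeasure_eq_measure ennreal_mult[symmetric])
            moreover have "measure M (?Z w \<inter> ?S -` A) * c \<le> measure M (?Z w \<inter> ?S -` A) * measure M (?S ` ?Z w)"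
              using mY by (intro mult_left_mono) auto
            ultimately have "measure M (?Z w \<inter> ?S -` A) \<le> C / c * (measure M A * measure M (?Z w))"
              using c by (simp add: field_simps)
            also have "\<dots> \<le> K * (measure M A * measure M (?Z w))"
              using K by (intro mult_right_mono) auto
            finally show ?thesis
              using K(1) unfolding eq by (simp add: M.emeasure_eq_measure ennreal_mult[symmetric] mult.assoc)
          qed
        qed (rule E)
        then show ?thesis
          using K(1) by (simp add: M.emeasure_eq_measure M.prob_space ennreal_mult[symmetric])
      qed
    qed
  qed
  with K(2) show ?thesis by (rule that)
qed

end


section \<open>Invariant densities\<close>

lemma measurable_funpow_self: "S \<in> M \<rightarrow>\<^sub>M M \<Longrightarrow> S ^^ n \<in> M \<rightarrow>\<^sub>M M"
  by (induction n) (auto intro: measurable_comp)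

text \<open>The density \<open>h\<close> is a limit of the averages of the measures \<open>A \<mapsto> m(S\<^sup>-\<^sup>k A)\<close>, \<open>k \<le> n\<close>, along
  a subsequence. Invariance holds because replacing \<open>A\<close> by \<open>S\<^sup>-\<^sup>1 A\<close> changes an average by at
  most \<open>1 / (n + 1)\<close>. The last two properties record that uniform bounds on \<open>m(S\<^sup>-\<^sup>k A)\<close> pass to
  the limit; they identify the marginal of \<open>h\<close> and show that its support is reached from almost
  everywhere.\<close>

lemma (in prob_space) invariant_density_of_power_bounded:
  assumes G: "countable_pi_generator M G" and S: "S \<in> M \<rightarrow>\<^sub>M M" and K: "0 \<le> K"
    and bound: "\<And>n A. A \<in> sets M \<Longrightarrow> measure M ((S ^^ n) -` A \<inter> space M) \<le> K * measure M A"
  obtains h :: "'a \<Rightarrow> real" where "h \<in> borel_measurable M" "\<And>x. 0 \<le> h x" "\<And>x. h x \<le> K"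
    "\<And>A. A \<in> sets M \<Longrightarrow> (\<integral>x. h x * indicator A (S x) \<partial>M) = (\<integral>x. h x * indicator A x \<partial>M)"
    "\<And>A c. A \<in> sets M \<Longrightarrow> (\<And>n. c \<le> measure M ((S ^^ n) -` A \<inter> space M)) \<Longrightarrow>
       c \<le> (\<integral>x. h x * indicator A x \<partial>M)"
    "\<And>A c. A \<in> sets M \<Longrightarrow> (\<And>n. measure M ((S ^^ n) -` A \<inter> space M) \<le> c) \<Longrightarrow>
       (\<integral>x. h x * indicator A x \<partial>M) \<le> c"
proof -
  define b where "b n A = measure M ((S ^^ n) -` A \<inter> space M)" for n A
  define a where "a n A = (\<Sum>k<Suc n. b k A) / real (Suc n)" for n A
  have pre: "(S ^^ n) -` A \<inter> space M \<in> sets M" if "A \<in> sets M" for n A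
    using measurable_sets[OF measurable_funpow_self[OF S] that] .
  have avg_le: "(\<Sum>k<Suc n. x k) / real (Suc n) \<le> c" if "\<And>k. x k \<le> c" for x :: "nat \<Rightarrow> real" and n c
    using sum_mono[of "{..<Suc n}" x "\<lambda>_. c"] that by (simp add: divide_le_eq mult.commute)
  have avg_ge: "c \<le> (\<Sum>k<Suc n. x k) / real (Suc n)" if "\<And>k. c \<le> x k" for x :: "nat \<Rightarrow> real" and n c
    using sum_mono[of "{..<Suc n}" "\<lambda>_. c" x] that by (simp add: le_divide_eq mult.commute)
  have dom: "dominated_additive M K (a n)" for n
    unfolding dominated_additive_def
  proof (intro conjI ballI impI)
    fix A assume A: "A \<in> sets M"
    show "0 \<le> a n A" unfolding a_def by (rule avg_ge) (simp add: b_def)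
    show "a n A \<le> K * measure M A" unfolding a_def by (rule avg_le) (simp add: b_def bound[OF A])
    fix B assume B: "B \<in> sets M" "A \<inter> B = {}"
    have "b k (A \<union> B) = b k A + b k B" for k
    proof -
      have "(S ^^ k) -` (A \<union> B) \<inter> space M = ((S ^^ k) -` A \<inter> space M) \<union> ((S ^^ k) -` B \<inter> space M)"
        by auto
      then show ?thesis
        unfolding b_def using pre[OF A] pre[OF B(1)] B(2) by (subst finite_measure_Union[symmetric]) auto
    qed
    then show "a n (A \<union> B) = a n A + a n B"
      by (simp add: a_def sum.distrib add_divide_distrib)
  qed
  show ?thesis
  proof (rule dominated_additive_compact[OF G dom K])
    fix r h assume r: "strict_mono r" and h: "h \<in> borel_measurable M" "\<And>x. 0 \<le> h x" "\<And>x. h x \<le> K"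
      and lim: "\<And>A. A \<in> sets M \<Longrightarrow> (\<lambda>n. a (r n) A) \<longlonglongrightarrow> (\<integral>x. h x * indicator A x \<partial>M)"
    show thesis
    proof (rule that[OF h])
      fix A assume A: "A \<in> sets M"
      let ?A = "S -` A \<inter> space M"
      have A': "?A \<in> sets M" using measurable_sets[OF S A] .
      have b: "b k ?A = b (Suc k) A" for k
      proof -
        have "(S ^^ k) -` ?A \<inter> space M = (S ^^ Suc k) -` A \<inter> space M"
          using measurable_space[OF measurable_funpow_self[OF S]] by auto
        then show ?thesis by (simp add: b_def)
      qed
      \<comment> \<open>The sums telescope: only the first and the last term survive.\<close>
      have diff: "\<bar>a n ?A - a n A\<bar> \<le> 1 / real (Suc n)" for n
      proof -
        have "(\<Sum>k<Suc n. b k ?A) - (\<Sum>k<Suc n. b k A) = b (Suc n) A - b 0 A"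
          unfolding b sum_subtractf[symmetric] by (rule sum_lessThan_telescope)
        then have "a n ?A - a n A = (b (Suc n) A - b 0 A) / real (Suc n)"
          unfolding a_def diff_divide_distrib[symmetric] by simp
        moreover have "\<bar>b (Suc n) A - b 0 A\<bar> \<le> 1"
          using prob_le_1[of "(S ^^ Suc n) -` A \<inter> space M"] prob_le_1[of "(S ^^ 0) -` A \<inter> space M"]
            measure_nonneg[of M "(S ^^ Suc n) -` A \<inter> space M"] measure_nonneg[of M "(S ^^ 0) -` A \<inter> space M"]
          unfolding b_def by linarith
        ultimately show ?thesis by (simp add: divide_right_mono)
      qed
      have "(\<lambda>n. 1 / real (Suc (r n))) \<longlonglongrightarrow> 0"
        using LIMSEQ_subseq_LIMSEQ[OF LIMSEQ_inverse_real_of_nat r] by (simp add: o_def inverse_eq_divide)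
      then have "(\<lambda>n. a (r n) ?A - a (r n) A) \<longlonglongrightarrow> 0"
        by (rule Lim_null_comparison[rotated])
          (unfold real_norm_def, intro always_eventually allI diff)
      moreover have "(\<lambda>n. a (r n) ?A - a (r n) A) \<longlonglongrightarrow>
          (\<integral>x. h x * indicator ?A x \<partial>M) - (\<integral>x. h x * indicator A x \<partial>M)"
        by (intro tendsto_diff lim A A')
      ultimately have "(\<integral>x. h x * indicator ?A x \<partial>M) = (\<integral>x. h x * indicator A x \<partial>M)"
        using LIMSEQ_unique by fastforce
      moreover have "(\<integral>x. h x * indicator ?A x \<partial>M) = (\<integral>x. h x * indicator A (S x) \<partial>M)"
        by (intro Bochner_Integration.integral_cong) (auto simp: indicator_def)
      ultimately show "(\<integral>x. h x * indicator A (S x) \<partial>M) = (\<integral>x. h x * indicator A x \<partial>M)" by simp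
    next
      fix A c assume A: "A \<in> sets M" and c: "\<And>n. c \<le> measure M ((S ^^ n) -` A \<inter> space M)"
      have "c \<le> a n A" for n unfolding a_def b_def by (rule avg_ge[OF c])
      then show "c \<le> (\<integral>x. h x * indicator A x \<partial>M)"
        by (intro LIMSEQ_le_const[OF lim[OF A]]) blast
    next
      fix A c assume A: "A \<in> sets M" and c: "\<And>n. measure M ((S ^^ n) -` A \<inter> space M) \<le> c"
      have "a n A \<le> c" for n unfolding a_def b_def by (rule avg_le[OF c])
      then show "(\<integral>x. h x * indicator A x \<partial>M) \<le> c"
        by (intro LIMSEQ_le_const2[OF lim[OF A]]) blast
    qed
  qed
qed

text \<open>By invariance the set where \<open>h\<close> vanishes has preimage of \<open>h m\<close>-measure zero.\<close>

lemma (in finite_measure) AE_invariant_density_support: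
  fixes h :: "'a \<Rightarrow> real"
  assumes S: "S \<in> M \<rightarrow>\<^sub>M M" and h: "integrable M h" "\<And>x. 0 \<le> h x"
    and inv: "\<And>A. A \<in> sets M \<Longrightarrow> (\<integral>x. h x * indicator A (S x) \<partial>M) = (\<integral>x. h x * indicator A x \<partial>M)"
  shows "AE x in M. h x \<noteq> 0 \<longrightarrow> h (S x) \<noteq> 0"
proof -
  have [measurable]: "S \<in> M \<rightarrow>\<^sub>M M" "h \<in> borel_measurable M" using S h by auto
  define A where "A = {x \<in> space M. h x = 0}"
  have A[measurable]: "A \<in> sets M" unfolding A_def by measurable
  have "(\<integral>x. h x * indicator A (S x) \<partial>M) = (\<integral>x. h x * indicator A x \<partial>M)" by (rule inv[OF A])
  also have "(\<lambda>x. h x * indicator A x) = (\<lambda>x. 0)" by (auto simp: A_def indicator_def)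
  finally have z: "(\<integral>x. h x * indicator A (S x) \<partial>M) = 0" by simp
  have "integrable M (\<lambda>x. h x * indicator A (S x))"
    by (rule Bochner_Integration.integrable_bound[OF h(1)]) (auto simp: indicator_def)
  then have "AE x in M. h x * indicator A (S x) = 0"
    using z h(2) by (subst integral_nonneg_eq_0_iff_AE[symmetric]) auto
  then show ?thesis
    using AE_space
    by eventually_elim (use measurable_space[OF S] in \<open>auto simp: A_def indicator_def\<close>)
qed

section \<open>The skew product\<close>

context random_system
begin

abbreviation "Z \<equiv> \<Omega> \<Otimes>\<^sub>M M"

definition skew :: "'w \<times> 'a \<Rightarrow> 'w \<times> 'a" where
  "skew z = (\<sigma> (fst z), T (fst z) (snd z))"

sublocale Z: pair_prob_space \<Omega> M ..

lemma T_measurable[measurable (raw)]: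
  assumes "f \<in> N \<rightarrow>\<^sub>M \<Omega>" "g \<in> N \<rightarrow>\<^sub>M M"
  shows "(\<lambda>z. T (f z) (g z)) \<in> N \<rightarrow>\<^sub>M M"
  using measurable_compose[OF measurable_Pair[OF assms] jointly_measurable] by simp

lemma cocycle_measurable[measurable (raw)]:
  assumes "f \<in> N \<rightarrow>\<^sub>M \<Omega>" "g \<in> N \<rightarrow>\<^sub>M M"
  shows "(\<lambda>z. cocycle \<sigma> T n (f z) (g z)) \<in> N \<rightarrow>\<^sub>M M"
proof (induction n)
  case (Suc n)
  show ?case
    using T_measurable[OF measurable_compose[OF assms(1) \<sigma>_pow_measurable[of n]] Suc] by simp
qed (simp add: assms)

lemma pullback_measurable:
  "(\<lambda>z. pullback_cocycle \<Omega> \<sigma> T n (fst z) (snd z)) \<in> Z \<rightarrow>\<^sub>M M"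
  unfolding pullback_cocycle_def
  by (rule cocycle_measurable[OF measurable_compose[OF measurable_fst \<tau>_pow_measurable] measurable_snd])

lemma skew_measurable[measurable]: "skew \<in> Z \<rightarrow>\<^sub>M Z"
  unfolding skew_def by measurable

lemma skew_pow: "(skew ^^ n) (\<omega>, x) = ((\<sigma> ^^ n) \<omega>, cocycle \<sigma> T n \<omega> x)"
  by (induction n) (auto simp: skew_def)

lemma AE_\<sigma>:
  assumes "AE \<omega> in \<Omega>. Q \<omega>"
  shows "AE \<omega> in \<Omega>. Q (\<sigma> \<omega>)"
  by (rule AE_distrD[OF \<sigma>_measurable]) (subst distr_\<sigma>, rule assms)

lemma distr_\<tau>: "distr \<Omega> \<Omega> \<tau> = \<Omega>"
proof -
  have "distr \<Omega> \<Omega> \<tau> = distr (distr \<Omega> \<Omega> \<sigma>) \<Omega> \<tau>" by (simp add: distr_\<sigma>)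
  also have "\<dots> = distr \<Omega> \<Omega> (\<lambda>\<omega>. \<omega>)"
    by (subst distr_distr[OF \<tau>_measurable \<sigma>_measurable], rule distr_cong) (simp_all add: \<tau>_\<sigma>)
  finally show ?thesis by (simp add: distr_id2)
qed

lemma AE_\<tau>:
  assumes "AE \<omega> in \<Omega>. Q \<omega>"
  shows "AE \<omega> in \<Omega>. Q (\<tau> \<omega>)"
  by (rule AE_distrD[OF \<tau>_measurable]) (subst distr_\<tau>, rule assms)

lemma nonsingular_skew: "nonsingular Z skew"
proof (rule nonsingularI)
  fix A assume A: "A \<in> null_sets Z"
  have "AE z in Z. z \<notin> A" by (rule AE_not_in[OF A])
  then have "AE \<omega> in \<Omega>. AE x in M. (\<omega>, x) \<notin> A" by (rule Z.AE_pair)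
  from AE_\<sigma>[OF this] have "AE \<omega> in \<Omega>. AE x in M. skew (\<omega>, x) \<notin> A"
    using AE_space
  proof eventually_elim
    case (elim \<omega>)
    show ?case using nonsingular_AE[OF nonsingular_fibre[OF elim(2)] elim(1)] by (simp add: skew_def)
  qed
  then have "AE z in Z. skew z \<notin> A"
    using A by (intro Z.AE_pair_measure) auto
  moreover have "skew -` A \<inter> space Z = {z \<in> space Z. \<not> skew z \<notin> A}" by auto
  moreover have "skew -` A \<inter> space Z \<in> sets Z" using A by (auto intro: measurable_sets)
  ultimately show "skew -` A \<inter> space Z \<in> null_sets Z"
    by (simp add: null_setsI AE_iff_measurable)
qed simp

text \<open>By Fubini the preimage under \<open>skew ^^ n\<close> has measure
  \<open>\<integral> m((T\<^sup>(\<^sup>n\<^sup>)\<^sub>\<omega>)\<^sup>-\<^sup>1 A\<^bsub>\<sigma>\<^sup>n \<omega>\<^esub>) d\<omega>\<close>. Since \<open>\<sigma>\<close> preserves the base measure, \<open>\<omega>\<close> may be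
  replaced by \<open>\<sigma>\<^sup>-\<^sup>n \<omega>\<close>, which turns the integrand into the one bounded by hypothesis.\<close>

lemma skew_measure_bound:
  assumes bound: "AE \<omega> in \<Omega>. \<forall>n. \<forall>A\<in>sets M.
       measure M (pullback_cocycle \<Omega> \<sigma> T n \<omega> -` A \<inter> space M) \<le> K * measure M A"
    and K: "0 \<le> K" and A: "A \<in> sets Z"
  shows "measure Z ((skew ^^ n) -` A \<inter> space Z) \<le> K * measure Z A"
proof -
  let ?S = "pullback_cocycle \<Omega> \<sigma> T n"
  \<comment> \<open>The fibre of \<open>B\<close> over \<open>\<omega>\<close> is the preimage of the fibre of \<open>A\<close> under the map arriving at \<open>\<omega>\<close>.\<close>
  define B where "B = (\<lambda>z. (fst z, ?S (fst z) (snd z))) -` A \<inter> space Z"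
  define \<phi> where "\<phi> \<omega> = emeasure M (Pair \<omega> -` B)" for \<omega>
  have [measurable]: "B \<in> sets Z"
    unfolding B_def by (rule measurable_sets[OF _ A]) (intro measurable_Pair measurable_fst pullback_measurable)
  have \<phi>_meas: "\<phi> \<in> borel_measurable \<Omega>"
    unfolding \<phi>_def by (rule M.measurable_emeasure_Pair) simp
  have E: "(skew ^^ n) -` A \<inter> space Z \<in> sets Z"
    by (rule measurable_sets[OF measurable_funpow_self[OF skew_measurable] A])
  have slice: "Pair \<omega> -` ((skew ^^ n) -` A \<inter> space Z) = Pair ((\<sigma> ^^ n) \<omega>) -` B" if "\<omega> \<in> space \<Omega>" for \<omega>
    using that by (auto simp: B_def skew_pow space_pair_measure \<sigma>_pow_in_space pullback_cocycle_def \<tau>_pow_\<sigma>_pow)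
  have "emeasure Z ((skew ^^ n) -` A \<inter> space Z) = (\<integral>\<^sup>+\<omega>. \<phi> ((\<sigma> ^^ n) \<omega>) \<partial>\<Omega>)"
    unfolding M.emeasure_pair_measure_alt[OF E] by (intro nn_integral_cong) (simp only: slice \<phi>_def)
  also have "\<dots> = (\<integral>\<^sup>+\<omega>. \<phi> \<omega> \<partial>distr \<Omega> \<Omega> (\<sigma> ^^ n))"
    using \<phi>_meas by (subst nn_integral_distr) auto
  also have "\<dots> = (\<integral>\<^sup>+\<omega>. \<phi> \<omega> \<partial>\<Omega>)" by (simp add: distr_\<sigma>_pow)
  also have "\<dots> \<le> (\<integral>\<^sup>+\<omega>. ennreal K * emeasure M (Pair \<omega> -` A) \<partial>\<Omega>)"
  proof (rule nn_integral_mono_AE)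
    show "AE \<omega> in \<Omega>. \<phi> \<omega> \<le> ennreal K * emeasure M (Pair \<omega> -` A)"
      using bound AE_space
    proof eventually_elim
      case (elim \<omega>)
      have "Pair \<omega> -` B = ?S \<omega> -` (Pair \<omega> -` A) \<inter> space M"
        using elim(2) by (auto simp: B_def space_pair_measure)
      moreover have "Pair \<omega> -` A \<in> sets M" by (rule sets_Pair1[OF A])
      ultimately have "measure M (Pair \<omega> -` B) \<le> K * measure M (Pair \<omega> -` A)" using elim(1) by simp
      then show ?case
        unfolding \<phi>_def using K by (simp add: M.emeasure_eq_measure ennreal_mult[symmetric] ennreal_leI)
    qed
  qed
  also have "\<dots> = ennreal K * emeasure Z A"
    using A by (subst nn_integral_cmult) (auto simp: M.emeasure_pair_measure_alt M.measurable_emeasure_Pair)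
  finally show ?thesis
    using K by (simp add: Z.emeasure_eq_measure ennreal_mult[symmetric])
qed

text \<open>The transfer operator of the skew product acts fibrewise, and thereby supplies the jointly
  measurable representative of the lift. Testing on rectangles \<open>B \<times> A\<close> identifies the integrals
  over \<open>A\<close> for almost every \<open>\<omega>\<close>; the exceptional null set depends on \<open>A\<close>, so \<open>A\<close> must be
  restricted to a countable generator before the quantifiers are exchanged.\<close>

lemma AE_perron_frobenius_skew_section:
  assumes f: "integrable Z f"
  shows "AE \<omega> in \<Omega>. AE x in M.
    perron_frobenius Z skew f (\<omega>, x) = perron_frobenius M (T (\<tau> \<omega>)) (\<lambda>y. f (\<tau> \<omega>, y)) x"
proof -
  obtain G where G: "countable_pi_generator M G"
    using countable_pi_generator_standard[OF standard_fibre] .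
  define F where "F = perron_frobenius Z skew f"
  have F: "integrable Z F" and F_spec: "\<And>g. g \<in> Linf Z \<Longrightarrow> (\<integral>z. F z * g z \<partial>Z) = (\<integral>z. f z * g (skew z) \<partial>Z)"
    unfolding F_def using Z.perron_frobenius_spec[OF nonsingular_skew f] by auto
  have [measurable]: "F \<in> borel_measurable Z" "f \<in> borel_measurable Z" using F f by auto
  have sections: "AE \<omega> in \<Omega>. (\<integral>x. F (\<omega>, x) * indicator A x \<partial>M)
      = (\<integral>x. f (\<tau> \<omega>, x) * indicator A (T (\<tau> \<omega>) x) \<partial>M)" if "A \<in> G" for A
  proof -
    have A[measurable]: "A \<in> sets M" by (rule countable_pi_generator_in_sets[OF G that])
    define p where "p \<omega> = (\<integral>x. F (\<omega>, x) * indicator A x \<partial>M)" for \<omega>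
    define q where "q \<omega> = (\<integral>x. f (\<omega>, x) * indicator A (T \<omega> x) \<partial>M)" for \<omega>
    have ind: "integrable Z (\<lambda>z. u z * indicator A (k z))" if "integrable Z u" "k \<in> Z \<rightarrow>\<^sub>M M" for u :: "_ \<Rightarrow> real" and k
      by (rule Bochner_Integration.integrable_bound[OF that(1)])
        (use that in \<open>auto simp: indicator_def\<close>)
    have F_int: "integrable Z (\<lambda>(\<omega>, x). F (\<omega>, x) * indicator A x)"
      using ind[OF F measurable_snd] by (simp add: case_prod_unfold)
    have f_int: "integrable Z (\<lambda>(\<omega>, x). f (\<omega>, x) * indicator A (T \<omega> x))"
      using ind[OF f, of "\<lambda>z. T (fst z) (snd z)"] by (simp add: case_prod_unfold)
    have p: "integrable \<Omega> p" unfolding p_def by (rule Z.integrable_fst[OF F_int])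
    have q: "integrable \<Omega> q" unfolding q_def by (rule Z.integrable_fst[OF f_int])
    have [measurable]: "p \<in> borel_measurable \<Omega>" "q \<in> borel_measurable \<Omega>" using p q by auto
    have q\<tau>: "integrable \<Omega> (\<lambda>\<omega>. q (\<tau> \<omega>))"
      using integrable_distr[OF \<tau>_measurable, of q] q by (simp add: distr_\<tau>)
    have "AE \<omega> in \<Omega>. p \<omega> = q (\<tau> \<omega>)"
    proof (rule density_unique_real[OF p q\<tau>])
      fix B assume B[measurable]: "B \<in> sets \<Omega>"
      have int_F: "integrable Z (\<lambda>z. F z * indicator (B \<times> A) z)"
        by (rule Bochner_Integration.integrable_bound[OF F]) (auto simp: indicator_def)
      have int_f: "integrable Z (\<lambda>z. f z * indicator (B \<times> A) (skew z))"
        by (rule Bochner_Integration.integrable_bound[OF f]) (auto simp: indicator_def)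
      have "(\<integral>\<omega>. indicator B \<omega> * p \<omega> \<partial>\<Omega>) = (\<integral>\<omega>. (\<integral>x. F (\<omega>, x) * indicator (B \<times> A) (\<omega>, x) \<partial>M) \<partial>\<Omega>)"
        unfolding p_def integral_mult_right_zero[symmetric]
        by (intro Bochner_Integration.integral_cong refl) (auto simp: indicator_def)
      also have "\<dots> = (\<integral>z. F z * indicator (B \<times> A) z \<partial>Z)"
        by (rule Z.integral_fst'[OF int_F])
      also have "\<dots> = (\<integral>z. f z * indicator (B \<times> A) (skew z) \<partial>Z)"
        by (intro F_spec indicator_Linf) simp
      also have "\<dots> = (\<integral>\<omega>. (\<integral>x. f (\<omega>, x) * indicator (B \<times> A) (skew (\<omega>, x)) \<partial>M) \<partial>\<Omega>)"
        by (rule Z.integral_fst'[OF int_f, symmetric])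
      also have "\<dots> = (\<integral>\<omega>. indicator B (\<sigma> \<omega>) * q \<omega> \<partial>\<Omega>)"
        unfolding q_def integral_mult_right_zero[symmetric]
        by (intro Bochner_Integration.integral_cong refl) (auto simp: indicator_def skew_def)
      also have "\<dots> = (\<integral>\<omega>. indicator B (\<sigma> \<omega>) * q (\<tau> (\<sigma> \<omega>)) \<partial>\<Omega>)"
        by (intro Bochner_Integration.integral_cong) (auto simp: \<tau>_\<sigma>)
      also have "\<dots> = (\<integral>\<omega>. indicator B \<omega> * q (\<tau> \<omega>) \<partial>distr \<Omega> \<Omega> \<sigma>)"
        by (subst integral_distr) auto
      also have "\<dots> = (\<integral>\<omega>. indicator B \<omega> * q (\<tau> \<omega>) \<partial>\<Omega>)" by (simp only: distr_\<sigma>)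
      finally show "(LINT \<omega>:B|\<Omega>. p \<omega>) = (LINT \<omega>:B|\<Omega>. q (\<tau> \<omega>))"
        by (simp add: set_lebesgue_integral_def)
    qed
    then show ?thesis by (simp add: p_def q_def)
  qed
  have "AE \<omega> in \<Omega>. \<forall>A\<in>G. (\<integral>x. F (\<omega>, x) * indicator A x \<partial>M)
      = (\<integral>x. f (\<tau> \<omega>, x) * indicator A (T (\<tau> \<omega>) x) \<partial>M)"
    using G sections by (simp add: AE_ball_countable countable_pi_generator_def)
  moreover have "AE \<omega> in \<Omega>. integrable M (\<lambda>x. F (\<omega>, x))" using Z.AE_integrable_fst'[OF F] .
  moreover have "AE \<omega> in \<Omega>. integrable M (\<lambda>x. f (\<tau> \<omega>, x))" using AE_\<tau>[OF Z.AE_integrable_fst'[OF f]] .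
  ultimately show ?thesis
    using AE_space
  proof eventually_elim
    case (elim \<omega>)
    have "nonsingular M (T (\<tau> \<omega>))"
      using elim(4) by (intro nonsingular_fibre) (rule measurable_space[OF \<tau>_measurable])
    then show ?case
      unfolding F_def[symmetric]
      using elim by (intro M.perron_frobenius_unique[OF G]) auto
  qed
qed

abbreviation "P \<equiv> \<lambda>\<omega>. perron_frobenius M (T \<omega>)"

lemma lift_operator_eq:
  assumes f: "integrable Z f"
  shows "integrable Z (lift_operator \<Omega> \<sigma> M P f)"
    and "AE z in Z. lift_operator \<Omega> \<sigma> M P f z = perron_frobenius Z skew f z"
proof -
  define F where "F = lift_operator \<Omega> \<sigma> M P f"
  let ?F = "perron_frobenius Z skew f"
  have F': "integrable Z ?F" by (rule Z.perron_frobenius_spec(1)[OF nonsingular_skew f])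
  have "\<exists>F. integrable Z F \<and> (AE \<omega> in \<Omega>. AE x in M. F (\<omega>, x) = P (\<tau> \<omega>) (\<lambda>y. f (\<tau> \<omega>, y)) x)"
    using F' AE_perron_frobenius_skew_section[OF f] by blast
  from someI_ex[OF this]
  have F: "integrable Z F" "AE \<omega> in \<Omega>. AE x in M. F (\<omega>, x) = P (\<tau> \<omega>) (\<lambda>y. f (\<tau> \<omega>, y)) x"
    by (simp_all add: F_def lift_operator_def)
  then show "integrable Z (lift_operator \<Omega> \<sigma> M P f)" by (simp add: F_def)
  have "AE \<omega> in \<Omega>. AE x in M. F (\<omega>, x) = ?F (\<omega>, x)"
    using F(2) AE_perron_frobenius_skew_section[OF f]
  proof eventually_elim
    case (elim \<omega>)
    then show ?case by eventually_elim simp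
  qed
  moreover have "{z \<in> space Z. F z = ?F z} \<in> sets Z"
    using borel_measurable_integrable[OF F(1)] borel_measurable_integrable[OF F'] by measurable
  ultimately show "AE z in Z. lift_operator \<Omega> \<sigma> M P f z = ?F z"
    unfolding F_def[symmetric] by (intro Z.AE_pair_measure)
qed

text \<open>The lift is the transfer operator of the skew product, whose adjoint is composition with the
  skew product; an element of \<open>L\<^sup>\<infinity>\<close> is determined by its pairings with indicators.\<close>

lemma lift_adjoint_eq:
  assumes g: "g \<in> Linf Z"
  shows "lift_adjoint \<Omega> \<sigma> M P g \<in> Linf Z"
    and "AE z in Z. lift_adjoint \<Omega> \<sigma> M P g z = g (skew z)"
proof -
  let ?L = "lift_operator \<Omega> \<sigma> M P"
  define G where "G = lift_adjoint \<Omega> \<sigma> M P g"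
  have dual: "(\<integral>z. ?L f z * g z \<partial>Z) = (\<integral>z. f z * g (skew z) \<partial>Z)" if f: "integrable Z f" for f
  proof -
    have [measurable]: "g \<in> borel_measurable Z" using g by (simp add: Linf_def)
    have "(\<integral>z. ?L f z * g z \<partial>Z) = (\<integral>z. perron_frobenius Z skew f z * g z \<partial>Z)"
      using borel_measurable_integrable[OF lift_operator_eq(1)[OF f]]
        borel_measurable_integrable[OF Z.perron_frobenius_spec(1)[OF nonsingular_skew f]]
        lift_operator_eq(2)[OF f]
      by (intro integral_cong_AE) auto
    then show ?thesis using Z.perron_frobenius_spec(2)[OF nonsingular_skew f g] by simp
  qed
  have g': "(\<lambda>z. g (skew z)) \<in> Linf Z" by (rule Linf_compose[OF nonsingular_skew g])
  have "\<exists>G. G \<in> Linf Z \<and> (\<forall>f. integrable Z f \<longrightarrow> (\<integral>z. ?L f z * g z \<partial>Z) = (\<integral>z. f z * G z \<partial>Z))"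
    using g' dual by blast
  from someI_ex[OF this]
  have G: "G \<in> Linf Z" "\<And>f. integrable Z f \<Longrightarrow> (\<integral>z. ?L f z * g z \<partial>Z) = (\<integral>z. f z * G z \<partial>Z)"
    unfolding G_def lift_adjoint_def by auto
  show "lift_adjoint \<Omega> \<sigma> M P g \<in> Linf Z" using G(1) by (simp add: G_def)
  have int: "integrable Z u" if "u \<in> Linf Z" for u
    using Z.integrable_mult_Linf[of "\<lambda>_. 1" u] that by simp
  show "AE z in Z. lift_adjoint \<Omega> \<sigma> M P g z = g (skew z)"
    unfolding G_def[symmetric]
  proof (rule density_unique_real[OF int[OF G(1)] int[OF g']])
    fix A assume A: "A \<in> sets Z"
    have "integrable Z (indicator A :: _ \<Rightarrow> real)" using A by (simp add: less_top[symmetric])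
    from G(2)[OF this] dual[OF this] show "(LINT z:A|Z. G z) = (LINT z:A|Z. g (skew z))"
      by (simp add: set_lebesgue_integral_def)
  qed
qed

lemma lift_adjoint_pow_eq:
  assumes g: "g \<in> Linf Z"
  shows "(lift_adjoint \<Omega> \<sigma> M P ^^ n) g \<in> Linf Z
    \<and> (AE z in Z. (lift_adjoint \<Omega> \<sigma> M P ^^ n) g z = g ((skew ^^ n) z))"
proof (induction n)
  case (Suc n)
  let ?g = "(lift_adjoint \<Omega> \<sigma> M P ^^ n) g"
  have "AE z in Z. lift_adjoint \<Omega> \<sigma> M P ?g z = ?g (skew z)"
    using Suc by (intro lift_adjoint_eq) simp
  moreover have "AE z in Z. ?g (skew z) = g ((skew ^^ n) (skew z))"
    using Suc by (intro nonsingular_AE[OF nonsingular_skew]) simp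
  ultimately have "AE z in Z. lift_adjoint \<Omega> \<sigma> M P ?g z = g ((skew ^^ Suc n) z)"
    by eventually_elim (simp add: funpow_swap1)
  then show ?case using Suc lift_adjoint_eq(1) by simp
qed (simp add: g)

lemma pullback_perron_frobenius:
  assumes \<omega>: "\<omega> \<in> space \<Omega>" and f: "integrable M f"
  shows "integrable M (pullback_cocycle \<Omega> \<sigma> P n \<omega> f)"
    and "g \<in> Linf M \<Longrightarrow>
      (\<integral>x. pullback_cocycle \<Omega> \<sigma> P n \<omega> f x * g x \<partial>M) = (\<integral>x. f x * g (pullback_cocycle \<Omega> \<sigma> T n \<omega> x) \<partial>M)"
proof -
  have "integrable M (cocycle \<sigma> P n \<eta> f) \<and> (\<forall>g\<in>Linf M.
      (\<integral>x. cocycle \<sigma> P n \<eta> f x * g x \<partial>M) = (\<integral>x. f x * g (cocycle \<sigma> T n \<eta> x) \<partial>M))"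
    if \<eta>: "\<eta> \<in> space \<Omega>" for \<eta>
  proof (induction n)
    case (Suc n)
    have ns: "nonsingular M (T ((\<sigma> ^^ n) \<eta>))" using \<eta> by (intro nonsingular_fibre \<sigma>_pow_in_space)
    note spec = M.perron_frobenius_spec[OF ns conjunct1[OF Suc]]
    show ?case using spec Suc Linf_compose[OF ns] by auto
  qed (simp add: f)
  from this[OF \<tau>_pow_in_space[OF \<omega>]]
  show "integrable M (pullback_cocycle \<Omega> \<sigma> P n \<omega> f)"
    and "g \<in> Linf M \<Longrightarrow>
      (\<integral>x. pullback_cocycle \<Omega> \<sigma> P n \<omega> f x * g x \<partial>M) = (\<integral>x. f x * g (pullback_cocycle \<Omega> \<sigma> T n \<omega> x) \<partial>M)"
    by (auto simp: pullback_cocycle_def)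
qed

end


section \<open>The random invariant density\<close>

context random_system
begin

text \<open>Duality gives \<open>\<integral> 1\<^sub>A P\<^sup>(\<^sup>n\<^sup>) 1 dm = m((T\<^sup>(\<^sup>n\<^sup>))\<^sup>-\<^sup>1 A)\<close>, so the bound on preimages is a
  bound on the densities.\<close>

lemma weakly_precompact_pullback_densities:
  assumes K: "0 \<le> K" and \<omega>: "\<omega> \<in> space \<Omega>"
    and bound: "\<And>n A. A \<in> sets M \<Longrightarrow>
      measure M (pullback_cocycle \<Omega> \<sigma> T n \<omega> -` A \<inter> space M) \<le> K * measure M A"
  shows "weakly_precompact_L1 M (range (\<lambda>n. pullback_cocycle \<Omega> \<sigma> P n \<omega> (indicator (space M))))"
proof -
  obtain G where G: "countable_pi_generator M G"
    using countable_pi_generator_standard[OF standard_fibre] .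
  have one: "integrable M (indicator (space M) :: 'a \<Rightarrow> real)"
    by (simp add: less_top[symmetric])
  show ?thesis
  proof (rule M.weakly_precompact_L1I[OF G K])
    fix f assume "f \<in> range (\<lambda>n. pullback_cocycle \<Omega> \<sigma> P n \<omega> (indicator (space M)))"
    then obtain n where f: "f = pullback_cocycle \<Omega> \<sigma> P n \<omega> (indicator (space M))" by auto
    let ?S = "pullback_cocycle \<Omega> \<sigma> T n \<omega>"
    show int: "integrable M f" unfolding f by (rule pullback_perron_frobenius(1)[OF \<omega> one])
    have S: "?S \<in> M \<rightarrow>\<^sub>M M" using nonsingular_pullback[OF \<omega>] by (simp add: nonsingular_def)
    have eq: "(\<integral>x. f x * indicator A x \<partial>M) = measure M (?S -` A \<inter> space M)" if A: "A \<in> sets M" for A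
    proof -
      have "(\<integral>x. f x * indicator A x \<partial>M) = (\<integral>x. indicator (space M) x * indicator A (?S x) \<partial>M)"
        unfolding f by (rule pullback_perron_frobenius(2)[OF \<omega> one indicator_Linf[OF A]])
      also have "\<dots> = (\<integral>x. indicator (?S -` A \<inter> space M) x \<partial>M)"
        by (intro Bochner_Integration.integral_cong) (auto simp: indicator_def)
      finally show ?thesis using measurable_sets[OF S A] by simp
    qed
    show "dominated_additive M K (\<lambda>A. \<integral>x. f x * indicator A x \<partial>M)"
      unfolding dominated_additive_def
    proof (intro conjI ballI impI)
      fix A assume A: "A \<in> sets M"
      show "0 \<le> (\<integral>x. f x * indicator A x \<partial>M)" by (simp add: eq[OF A])
      show "(\<integral>x. f x * indicator A x \<partial>M) \<le> K * measure M A"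
        unfolding eq[OF A] by (rule bound[OF A])
      fix B assume B: "B \<in> sets M" "A \<inter> B = {}"
      have "?S -` (A \<union> B) \<inter> space M = (?S -` A \<inter> space M) \<union> (?S -` B \<inter> space M)" by auto
      moreover have "measure M \<dots> = measure M (?S -` A \<inter> space M) + measure M (?S -` B \<inter> space M)"
        using measurable_sets[OF S A] measurable_sets[OF S B(1)] B(2)
        by (intro M.finite_measure_Union) auto
      ultimately show "(\<integral>x. f x * indicator (A \<union> B) x \<partial>M)
          = (\<integral>x. f x * indicator A x \<partial>M) + (\<integral>x. f x * indicator B x \<partial>M)"
        using A B by (simp only: eq sets.Un)
    qed
  qed
qed

lemma AE_section_integral_eq_1:
  fixes h :: "'w \<times> 'a \<Rightarrow> real"
  assumes h: "integrable Z h"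
    and marginal: "\<And>B. B \<in> sets \<Omega> \<Longrightarrow> (\<integral>z. h z * indicator (B \<times> space M) z \<partial>Z) = measure \<Omega> B"
  shows "AE \<omega> in \<Omega>. (\<integral>x. h (\<omega>, x) \<partial>M) = 1"
proof (rule density_unique_real)
  show "integrable \<Omega> (\<lambda>\<omega>. \<integral>x. h (\<omega>, x) \<partial>M)" by (rule Z.integrable_fst'[OF h])
  show "integrable \<Omega> (\<lambda>_. 1 :: real)" by simp
  have [measurable]: "h \<in> borel_measurable Z" using h by auto
  fix B assume B[measurable]: "B \<in> sets \<Omega>"
  have int: "integrable Z (\<lambda>z. h z * indicator (B \<times> space M) z)"
    by (rule Bochner_Integration.integrable_bound[OF h]) (auto simp: indicator_def)
  have "(\<integral>\<omega>. indicator B \<omega> * (\<integral>x. h (\<omega>, x) \<partial>M) \<partial>\<Omega>)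
      = (\<integral>\<omega>. (\<integral>x. h (\<omega>, x) * indicator (B \<times> space M) (\<omega>, x) \<partial>M) \<partial>\<Omega>)"
    unfolding integral_mult_right_zero[symmetric]
    by (intro Bochner_Integration.integral_cong refl) (auto simp: indicator_def)
  also have "\<dots> = measure \<Omega> B" using Z.integral_fst'[OF int] marginal[OF B] by simp
  finally show "(LINT \<omega>:B|\<Omega>. (\<integral>x. h (\<omega>, x) \<partial>M)) = (LINT \<omega>:B|\<Omega>. 1)"
    by (simp add: set_lebesgue_integral_def)
qed

lemma skew_pow_vimage_rectangle:
  "(skew ^^ n) -` (B \<times> space M) \<inter> space Z = ((\<sigma> ^^ n) -` B \<inter> space \<Omega>) \<times> space M"
  using measurable_space[OF measurable_funpow_self[OF skew_measurable, of n]]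
  by (fastforce simp: space_pair_measure skew_pow)

lemma measure_skew_pow_vimage_rectangle:
  assumes B: "B \<in> sets \<Omega>"
  shows "measure Z ((skew ^^ n) -` (B \<times> space M) \<inter> space Z) = measure \<Omega> B"
proof -
  have B': "(\<sigma> ^^ n) -` B \<inter> space \<Omega> \<in> sets \<Omega>" by (rule measurable_sets[OF \<sigma>_pow_measurable B])
  have "emeasure Z (((\<sigma> ^^ n) -` B \<inter> space \<Omega>) \<times> space M) = emeasure \<Omega> ((\<sigma> ^^ n) -` B \<inter> space \<Omega>)"
    using B' by (subst M.emeasure_pair_measure_Times) (auto simp: M.emeasure_space_1)
  also have "\<dots> = emeasure (distr \<Omega> \<Omega> (\<sigma> ^^ n)) B" by (rule emeasure_distr[symmetric]) (use B in auto)
  also have "\<dots> = emeasure \<Omega> B" by (simp only: distr_\<sigma>_pow)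
  finally show ?thesis by (simp only: skew_pow_vimage_rectangle measure_def)
qed

text \<open>The \<open>n\<close>-th function is the indicator of the event of being in \<open>S\<close> at time \<open>n\<close>. If almost
  every orbit enters \<open>S\<close> and never leaves it again, these indicators increase to \<open>1\<close>.\<close>

lemma AE_lift_adjoint_pow_indicator:
  assumes S: "S \<in> sets Z" and fwd: "AE z in Z. z \<in> S \<longrightarrow> skew z \<in> S"
    and hit: "AE z in Z. \<exists>n. (skew ^^ n) z \<in> S"
  shows "AE z in Z. incseq (\<lambda>n. (lift_adjoint \<Omega> \<sigma> M P ^^ n) (indicator S) z) \<and>
     (\<lambda>n. (lift_adjoint \<Omega> \<sigma> M P ^^ n) (indicator S) z) \<longlonglongrightarrow> 1"
proof -
  have "AE z in Z. \<forall>n. (lift_adjoint \<Omega> \<sigma> M P ^^ n) (indicator S) z = indicator S ((skew ^^ n) z)"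
    using lift_adjoint_pow_eq[OF indicator_Linf[OF S]] by (simp add: AE_all_countable)
  moreover have "AE z in Z. \<forall>n. (skew ^^ n) z \<in> S \<longrightarrow> (skew ^^ Suc n) z \<in> S"
  proof -
    have "AE z in Z. (skew ^^ n) z \<in> S \<longrightarrow> skew ((skew ^^ n) z) \<in> S" for n
    proof (induction n)
      case (Suc n)
      from nonsingular_AE[OF nonsingular_skew Suc] show ?case by (simp add: funpow_swap1)
    qed (simp add: fwd)
    then show ?thesis by (simp add: AE_all_countable)
  qed
  ultimately show ?thesis
    using hit
  proof eventually_elim
    case (elim z)
    let ?u = "\<lambda>n. indicator S ((skew ^^ n) z) :: real"
    have inc: "incseq ?u"
      by (rule incseq_SucI) (use elim(2) in \<open>auto simp: indicator_def\<close>)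
    obtain m where m: "(skew ^^ m) z \<in> S" using elim(3) by auto
    have "?u n = 1" if "m \<le> n" for n
      using incseqD[OF inc that] m by (cases "(skew ^^ n) z \<in> S") simp_all
    then have "?u \<longlonglongrightarrow> 1"
      by (intro tendsto_eventually) (auto simp: eventually_sequentially)
    with inc show ?case using elim(1) by simp
  qed
qed

text \<open>The invariant density of the skew product is the required \<open>h\<close>. Its marginal on \<open>\<Omega>\<close> is the
  base measure because the preimage of \<open>A \<times> X\<close> under \<open>skew ^^ n\<close> is \<open>\<sigma>\<^sup>-\<^sup>n A \<times> X\<close>. The set \<open>B\<close> of
  points whose orbits avoid the support lies in all its preimages, so the averages that define
  \<open>h\<close> give it at least its own measure; but \<open>h\<close> vanishes on it, so it is null.\<close>

lemma random_invariant_density_exists: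
  assumes K: "0 \<le> K"
    and bound: "AE \<omega> in \<Omega>. \<forall>n. \<forall>A\<in>sets M.
       measure M (pullback_cocycle \<Omega> \<sigma> T n \<omega> -` A \<inter> space M) \<le> K * measure M A"
  shows "\<exists>h. random_invariant_density \<Omega> \<sigma> M P h \<and> integrable Z (case_prod h) \<and>
    (AE z in Z. incseq (\<lambda>n. (lift_adjoint \<Omega> \<sigma> M P ^^ n) (indicator (random_support \<Omega> M h)) z) \<and>
       (\<lambda>n. (lift_adjoint \<Omega> \<sigma> M P ^^ n) (indicator (random_support \<Omega> M h)) z) \<longlonglongrightarrow> 1)"
proof -
  obtain G1 G2 where "countable_pi_generator \<Omega> G1" "countable_pi_generator M G2"
    using countable_pi_generator_standard[OF standard_base]
      countable_pi_generator_standard[OF standard_fibre] by metis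
  then obtain G where G: "countable_pi_generator Z G"
    using countable_pi_generator_pair by blast
  show ?thesis
  proof (rule Z.invariant_density_of_power_bounded[OF G skew_measurable K
      skew_measure_bound[OF bound K]])
    fix h :: "'w \<times> 'a \<Rightarrow> real"
    assume h[measurable]: "h \<in> borel_measurable Z" and h0: "\<And>z. 0 \<le> h z" and hK: "\<And>z. h z \<le> K"
      and inv: "\<And>A. A \<in> sets Z \<Longrightarrow>
        (\<integral>z. h z * indicator A (skew z) \<partial>Z) = (\<integral>z. h z * indicator A z \<partial>Z)"
      and ge: "\<And>A c. A \<in> sets Z \<Longrightarrow> (\<And>n. c \<le> measure Z ((skew ^^ n) -` A \<inter> space Z)) \<Longrightarrow>
        c \<le> (\<integral>z. h z * indicator A z \<partial>Z)"
      and le: "\<And>A c. A \<in> sets Z \<Longrightarrow> (\<And>n. measure Z ((skew ^^ n) -` A \<inter> space Z) \<le> c) \<Longrightarrow>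
        (\<integral>z. h z * indicator A z \<partial>Z) \<le> c"
    have int: "integrable Z h"
      using h0 hK by (intro Z.integrable_const_bound[of _ K]) auto
    have section_int: "integrable M (\<lambda>x. h (\<omega>, x))" if "\<omega> \<in> space \<Omega>" for \<omega>
      using h0 hK measurable_compose[OF measurable_Pair1'[OF that] h]
      by (intro M.integrable_const_bound[of _ K]) auto
    have "(\<integral>z. h z * indicator (B \<times> space M) z \<partial>Z) = measure \<Omega> B" if B: "B \<in> sets \<Omega>" for B
      using B by (intro antisym ge le) (simp_all add: measure_skew_pow_vimage_rectangle[OF B])
    then have mass: "AE \<omega> in \<Omega>. (\<integral>x. h (\<omega>, x) \<partial>M) = 1"
      by (rule AE_section_integral_eq_1[OF int])
    have fixed: "AE z in Z. h z = perron_frobenius Z skew h z"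
      using inv countable_pi_generator_in_sets[OF G]
      by (intro Z.perron_frobenius_unique[OF G nonsingular_skew int int]) simp
    have "AE \<omega> in \<Omega>. AE x in M. h (\<omega>, x) = P (\<tau> \<omega>) (\<lambda>y. h (\<tau> \<omega>, y)) x"
      using Z.AE_pair[OF fixed] AE_perron_frobenius_skew_section[OF int]
    proof eventually_elim
      case (elim \<omega>)
      then show ?case by eventually_elim simp
    qed
    from AE_\<sigma>[OF this]
    have equivariant: "AE \<omega> in \<Omega>. AE x in M. P \<omega> (\<lambda>y. h (\<omega>, y)) x = h (\<sigma> \<omega>, x)"
      using AE_space
    proof eventually_elim
      case (elim \<omega>)
      from elim(1) show ?case by eventually_elim (simp add: \<tau>_\<sigma> elim(2))
    qed
    define S where "S = {z \<in> space Z. h z \<noteq> 0}"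
    have S: "S \<in> sets Z" unfolding S_def by measurable
    have in_space: "(skew ^^ n) z \<in> space Z" if "z \<in> space Z" for n z
      using measurable_space[OF measurable_funpow_self[OF skew_measurable] that] .
    have "AE z in Z. h z \<noteq> 0 \<longrightarrow> h (skew z) \<noteq> 0"
      by (rule Z.AE_invariant_density_support[OF skew_measurable int h0 inv])
    then have fwd: "AE z in Z. z \<in> S \<longrightarrow> skew z \<in> S"
      using AE_space
      by eventually_elim (use in_space[of _ 1] in \<open>auto simp: S_def\<close>)
    have hit: "AE z in Z. \<exists>n. (skew ^^ n) z \<in> S"
    proof -
      define B where "B = {z \<in> space Z. \<forall>n. (skew ^^ n) z \<notin> S}"
      have pre: "(skew ^^ n) -` S \<inter> space Z \<in> sets Z" for n
        by (rule measurable_sets[OF measurable_funpow_self[OF skew_measurable] S])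
      have "B = space Z - (\<Union>n. (skew ^^ n) -` S \<inter> space Z)"
        unfolding B_def by blast
      then have B: "B \<in> sets Z" using pre by (metis sets.compl_sets sets.countable_UN image_subsetI)
      have "measure Z B \<le> (\<integral>z. h z * indicator B z \<partial>Z)"
      proof (rule ge[OF B])
        fix n
        have "(skew ^^ k) ((skew ^^ n) z) \<notin> S" if "z \<in> B" for k z
        proof -
          have "(skew ^^ k) ((skew ^^ n) z) = (skew ^^ (k + n)) z" by (simp add: funpow_add)
          then show ?thesis using that unfolding B_def by (metis (mono_tags, lifting) mem_Collect_eq)
        qed
        then have "B \<subseteq> (skew ^^ n) -` B \<inter> space Z"
          using in_space unfolding B_def by blast
        then show "measure Z B \<le> measure Z ((skew ^^ n) -` B \<inter> space Z)"
          by (intro Z.finite_measure_mono measurable_sets[OF measurable_funpow_self[OF skew_measurable] B])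
      qed
      also have "(\<lambda>z. h z * indicator B z) = (\<lambda>z. 0)"
      proof
        fix z show "h z * indicator B z = 0"
          by (cases "z \<in> B") (auto simp: B_def S_def dest: spec[of _ 0])
      qed
      finally have "measure Z B = 0" by (simp add: measure_le_0_iff)
      then have "B \<in> null_sets Z" using B by (simp add: null_sets_def Z.emeasure_eq_measure)
      then have "AE z in Z. z \<notin> B" by (rule AE_not_in)
      then show ?thesis
        using AE_space
      proof eventually_elim
        case (elim z)
        then show ?case unfolding B_def by blast
      qed
    qed
    have supp: "random_support \<Omega> M (curry h) = S" by (auto simp: random_support_def S_def)
    have "random_invariant_density \<Omega> \<sigma> M P (curry h)"
      unfolding random_invariant_density_def
    proof (intro conjI ballI)
      show "case_prod (curry h) \<in> borel_measurable Z" by (simp add: h)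
      show "integrable M (curry h \<omega>)" if "\<omega> \<in> space \<Omega>" for \<omega>
        using section_int[OF that] by (simp add: curry_def)
      show "AE \<omega> in \<Omega>. (AE x in M. 0 \<le> curry h \<omega> x) \<and> (\<integral>x. \<bar>curry h \<omega> x\<bar> \<partial>M) = 1 \<and>
          (AE x in M. P \<omega> (curry h \<omega>) x = curry h (\<sigma> \<omega>) x)"
        using mass equivariant
        by eventually_elim (simp add: h0 curry_def)
    qed
    moreover have "integrable Z (case_prod (curry h))" using int by simp
    ultimately show ?thesis
      using AE_lift_adjoint_pow_indicator[OF S fwd hit] unfolding supp[symmetric] by blast
  qed
qed

end

theorem proposition2p1:
  fixes \<Omega> :: "'w measure" and \<sigma> :: "'w \<Rightarrow> 'w"
    and M :: "'a measure" and T :: "'w \<Rightarrow> 'a \<Rightarrow> 'a"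
    and I :: "'i set" and X :: "'i \<Rightarrow> 'a set"
    and P :: "'w \<Rightarrow> ('a \<Rightarrow> real) \<Rightarrow> 'a \<Rightarrow> real"
  assumes "random_fibered_system \<Omega> \<sigma> M T I X"
    and "\<And>\<omega>. P \<omega> = perron_frobenius M (T \<omega>)"
  shows "(AE \<omega> in \<Omega>. weakly_precompact_L1 M
            (range (\<lambda>n. pullback_cocycle \<Omega> \<sigma> P n \<omega> (indicator (space M))))) \<and>
         (\<exists>h. random_invariant_density \<Omega> \<sigma> M P h \<and>
            integrable (\<Omega> \<Otimes>\<^sub>M M) (case_prod h) \<and>
            (AE z in \<Omega> \<Otimes>\<^sub>M M.
               incseq (\<lambda>n. (lift_adjoint \<Omega> \<sigma> M P ^^ n) (indicator (random_support \<Omega> M h)) z) \<and>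
               (\<lambda>n. (lift_adjoint \<Omega> \<sigma> M P ^^ n) (indicator (random_support \<Omega> M h)) z) \<longlonglongrightarrow> 1))"
proof -
  interpret random_fibered_system \<Omega> \<sigma> M T I X by (rule assms(1))
  have P: "P = (\<lambda>\<omega>. perron_frobenius M (T \<omega>))" using assms(2) by (rule ext)
  obtain K where K: "1 \<le> K" and bound: "AE \<omega> in \<Omega>. \<forall>n. \<forall>A\<in>sets M.
       measure M (pullback_cocycle \<Omega> \<sigma> T n \<omega> -` A \<inter> space M) \<le> K * measure M A"
    by (rule pullback_measure_bound)
  have K0: "0 \<le> K" using K by simp
  have "AE \<omega> in \<Omega>. weakly_precompact_L1 M
      (range (\<lambda>n. pullback_cocycle \<Omega> \<sigma> P n \<omega> (indicator (space M))))"
    using bound AE_space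
    unfolding P by eventually_elim (intro weakly_precompact_pullback_densities[OF K0]; simp)
  then show ?thesis
    using random_invariant_density_exists[OF K0 bound] unfolding P by blast
qed

end
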